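(* The congruence biframe functor $\mathbb{C}:\mathbf{Frm}\to\mathbf{Str0DBiFrm}$ and the first-part functor $\mathcal{P}:\mathbf{Str0DBiFrm}\to\mathbf{Frm}$ restrict to an equivalence between the category of Noetherian frames (with frame homomorphisms) and the category of compact strictly zero-dimensional biframes (with biframe homomorphisms).
   Context: A biframe is a triple $M=(M_0,M_1,M_2)$ where $M_0$ is a frame (the total part) and $M_1,M_2$ are subframes of $M_0$ whose union generates $M_0$. A biframe homomorphism $M\to N$ is a frame homomorphism $M_0\to N_0$ mapping $M_i$ into $N_i$ for $i=1,2$. A biframe is compact if its total part is a compact frame. A biframe $M$ is strictly zero-dimensional if every $a\in M_1$ is complemented in $M_0$ with its complement lying in $M_2$, and these complements generate $M_2$. $\mathbf{Str0DBiFrm}$ is the category of strictly zero-dimensional biframes and biframe homomorphisms; $\mathbf{Frm}$ is the category of frames. $\mathcal{P}$ sends $M$ to $M_1$ and a homomorphism to its restriction to first parts. A frame is Noetherian if all of its elements are compact. For a frame $L$, let $\mathbb{C}L$ also denote the frame of all frame congruences on $L$ ordered by inclusion (a congruence is an equivalence relation closed under finite meets and arbitrary joins in $L\times L$). For $a\in L$ let $\nabla_a=\langle(0,a)\rangle$ and $\Delta_a=\langle(a,1)\rangle$ be the congruences generated by the indicated pairs. The congruence biframe is $\mathbb{C}L=(\mathbb{C}L,\nabla L,\Delta L)$ where $\nabla L=\{\nabla_a\mid a\in L\}$ and $\Delta L$ is the subframe generated by $\{\Delta_a\mid a\in L\}$; it is strictly zero-dimensional. For a frame homomorphism $f:L\to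 M$, $\mathbb{C}f$ is the unique frame homomorphism with $\mathbb{C}f(\nabla_a)=\nabla_{f(a)}$ for all $a\in L$; it is a biframe homomorphism. *)

theory Defs
  imports "HOL-Algebra.Complete_Lattice"
begin

locale frame = complete_lattice +
  assumes inf_sup_distrib:
    "\<lbrakk>a \<in> carrier L; S \<subseteq> carrier L\<rbrakk> \<Longrightarrow> a \<sqinter> \<Squnion>S = \<Squnion>((\<lambda>s. a \<sqinter> s) ` S)"

text \<open>
  Morphisms are extensional functions, so that equality of morphisms is equality in HOL and the
  identity on \<open>L\<close> and composition are \<open>\<lambda>x\<in>carrier L. x\<close> and \<^const>\<open>compose\<close>.
  The case \<open>S = {}\<close> of the last clause is preservation of the bottom element.
\<close>

definition frame_hom :: "'a gorder \<Rightarrow> 'b gorder \<Rightarrow> ('a \<Rightarrow> 'b) set" where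
  "frame_hom L M = {f \<in> carrier L \<rightarrow>\<^sub>E carrier M.
     f \<top>\<^bsub>L\<^esub> = \<top>\<^bsub>M\<^esub> \<and>
     (\<forall>a\<in>carrier L. \<forall>b\<in>carrier L. f (a \<sqinter>\<^bsub>L\<^esub> b) = f a \<sqinter>\<^bsub>M\<^esub> f b) \<and>
     (\<forall>S\<subseteq>carrier L. f (\<Squnion>\<^bsub>L\<^esub>S) = \<Squnion>\<^bsub>M\<^esub>(f ` S))}"

definition frame_iso :: "'a gorder \<Rightarrow> 'b gorder \<Rightarrow> ('a \<Rightarrow> 'b) set" where
  "frame_iso L M = {f \<in> frame_hom L M. \<exists>g\<in>frame_hom M L.
     compose (carrier L) g f = (\<lambda>x\<in>carrier L. x) \<and>
     compose (carrier M) f g = (\<lambda>y\<in>carrier M. y)}"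

definition subframe :: "'a gorder \<Rightarrow> 'a set \<Rightarrow> bool" where
  "subframe L S \<longleftrightarrow> S \<subseteq> carrier L \<and> \<top>\<^bsub>L\<^esub> \<in> S \<and>
     (\<forall>a\<in>S. \<forall>b\<in>S. a \<sqinter>\<^bsub>L\<^esub> b \<in> S) \<and> (\<forall>T\<subseteq>S. \<Squnion>\<^bsub>L\<^esub>T \<in> S)"

definition generated_subframe :: "'a gorder \<Rightarrow> 'a set \<Rightarrow> 'a set" where
  "generated_subframe L X = \<Inter>{S. subframe L S \<and> X \<subseteq> S}"

definition complement_in :: "'a gorder \<Rightarrow> 'a \<Rightarrow> 'a \<Rightarrow> bool" where
  "complement_in L a c \<longleftrightarrow> c \<in> carrier L \<and> a \<sqinter>\<^bsub>L\<^esub> c = \<bottom>\<^bsub>L\<^esub> \<and> a \<squnion>\<^bsub>L\<^esub> c = \<top>\<^bsub>L\<^esub>"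

definition compact_element :: "'a gorder \<Rightarrow> 'a \<Rightarrow> bool" where
  "compact_element L a \<longleftrightarrow> a \<in> carrier L \<and>
     (\<forall>S\<subseteq>carrier L. a \<sqsubseteq>\<^bsub>L\<^esub> \<Squnion>\<^bsub>L\<^esub>S \<longrightarrow> (\<exists>F\<subseteq>S. finite F \<and> a \<sqsubseteq>\<^bsub>L\<^esub> \<Squnion>\<^bsub>L\<^esub>F))"

definition compact_frame :: "'a gorder \<Rightarrow> bool" where
  "compact_frame L \<longleftrightarrow> frame L \<and> compact_element L \<top>\<^bsub>L\<^esub>"

definition Frm :: "'a gorder set" where
  "Frm = {L. frame L}"

definition NoethFrm :: "'a gorder set" where
  "NoethFrm = {L \<in> Frm. \<forall>a\<in>carrier L. compact_element L a}"

record 'a biframe =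
  total :: "'a gorder"
  first :: "'a set"
  second :: "'a set"

definition is_biframe :: "'a biframe \<Rightarrow> bool" where
  "is_biframe M \<longleftrightarrow> frame (total M) \<and>
     subframe (total M) (first M) \<and> subframe (total M) (second M) \<and>
     generated_subframe (total M) (first M \<union> second M) = carrier (total M)"

definition biframe_hom :: "'a biframe \<Rightarrow> 'b biframe \<Rightarrow> ('a \<Rightarrow> 'b) set" where
  "biframe_hom M N = {f \<in> frame_hom (total M) (total N).
     f ` first M \<subseteq> first N \<and> f ` second M \<subseteq> second N}"

definition biframe_iso :: "'a biframe \<Rightarrow> 'b biframe \<Rightarrow> ('a \<Rightarrow> 'b) set" where
  "biframe_iso M N = {f \<in> biframe_hom M N. \<exists>g\<in>biframe_hom N M.
     compose (carrier (total M)) g f = (\<lambda>x\<in>carrier (total M). x) \<and>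
     compose (carrier (total N)) f g = (\<lambda>y\<in>carrier (total N). y)}"

definition Str0DBiFrm :: "'a biframe set" where
  "Str0DBiFrm = {M. is_biframe M \<and>
     (\<forall>a\<in>first M. \<exists>c\<in>second M. complement_in (total M) a c) \<and>
     second M = generated_subframe (total M) {c. \<exists>a\<in>first M. complement_in (total M) a c}}"

definition CompactStr0DBiFrm :: "'a biframe set" where
  "CompactStr0DBiFrm = {M \<in> Str0DBiFrm. compact_frame (total M)}"

definition frame_congruence :: "'a gorder \<Rightarrow> ('a \<times> 'a) set \<Rightarrow> bool" where
  "frame_congruence L \<theta> \<longleftrightarrow> equiv (carrier L) \<theta> \<and>
     (\<forall>(a, b)\<in>\<theta>. \<forall>(c, d)\<in>\<theta>. (a \<sqinter>\<^bsub>L\<^esub> c, b \<sqinter>\<^bsub>L\<^esub> d) \<in> \<theta>) \<and>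
     (\<forall>R\<subseteq>\<theta>. (\<Squnion>\<^bsub>L\<^esub>(fst ` R), \<Squnion>\<^bsub>L\<^esub>(snd ` R)) \<in> \<theta>)"

definition generated_congruence :: "'a gorder \<Rightarrow> ('a \<times> 'a) set \<Rightarrow> ('a \<times> 'a) set" where
  "generated_congruence L R = \<Inter>{\<theta>. frame_congruence L \<theta> \<and> R \<subseteq> \<theta>}"

definition nabla :: "'a gorder \<Rightarrow> 'a \<Rightarrow> ('a \<times> 'a) set" where
  "nabla L a = generated_congruence L {(\<bottom>\<^bsub>L\<^esub>, a)}"

definition delta :: "'a gorder \<Rightarrow> 'a \<Rightarrow> ('a \<times> 'a) set" where
  "delta L a = generated_congruence L {(a, \<top>\<^bsub>L\<^esub>)}"

definition congruence_frame :: "'a gorder \<Rightarrow> ('a \<times> 'a) set gorder" where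
  "congruence_frame L = \<lparr>carrier = {\<theta>. frame_congruence L \<theta>}, eq = (=), le = (\<subseteq>)\<rparr>"

definition cong_biframe :: "'a gorder \<Rightarrow> ('a \<times> 'a) set biframe" where
  "cong_biframe L = \<lparr>total = congruence_frame L, first = nabla L ` carrier L,
     second = generated_subframe (congruence_frame L) (delta L ` carrier L)\<rparr>"

definition cong_map ::
    "'a gorder \<Rightarrow> 'b gorder \<Rightarrow> ('a \<Rightarrow> 'b) \<Rightarrow> ('a \<times> 'a) set \<Rightarrow> ('b \<times> 'b) set" where
  "cong_map L M f = (THE h. h \<in> frame_hom (congruence_frame L) (congruence_frame M) \<and>
     (\<forall>a\<in>carrier L. h (nabla L a) = nabla M (f a)))"

definition first_part :: "'a biframe \<Rightarrow> 'a gorder" where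
  "first_part M = (total M)\<lparr>carrier := first M\<rparr>"

definition first_part_map :: "'a biframe \<Rightarrow> ('a \<Rightarrow> 'b) \<Rightarrow> 'a \<Rightarrow> 'b" where
  "first_part_map M f = restrict f (first M)"

text \<open>
  The congruences of a frame over the type \<open>'a\<close> live in the type \<open>('a \<times> 'a) set\<close>, so the functor
  \<open>L \<mapsto> cong_biframe L\<close> changes the type and its composites with \<open>first_part\<close> are not endofunctors of
  a category over one fixed type. The categories are therefore treated as ranging over all
  types: the hom-sets above are between structures over possibly different types. As HOL cannot
  quantify existentially over a polymorphic family, the two natural isomorphisms are named:
  \<open>unit L\<close> goes from \<open>L\<close> to the first part of its congruence biframe, and \<open>counit M\<close> from the
  congruence biframe of the first part of \<open>M\<close> to \<open>M\<close>.
\<close>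

definition unit :: "'a gorder \<Rightarrow> 'a \<Rightarrow> ('a \<times> 'a) set" where
  "unit L = (\<lambda>a\<in>carrier L. nabla L a)"

definition counit :: "'a biframe \<Rightarrow> ('a \<times> 'a) set \<Rightarrow> 'a" where
  "counit M = (THE h. h \<in> frame_hom (congruence_frame (first_part M)) (total M) \<and>
     (\<forall>a\<in>first M. h (nabla (first_part M) a) = a))"

end

theory Submission
  imports Defs
begin

text \<open>
  Everything follows from the universal property of the congruence frame: a frame homomorphism
  \<open>g : L \<rightarrow> N\<close> whose values are all complemented extends uniquely along \<open>a \<mapsto> nabla L a\<close> to a frame
  homomorphism from the congruences of \<open>L\<close> to \<open>N\<close> (\<open>ext_hom\<close>, \<open>ext_nabla\<close>, \<open>the_ext\<close>). The action of
  the congruence functor on morphisms and the counit are the extensions of \<open>a \<mapsto> nabla M (f a)\<close> and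
  of the inclusion of the first part. Functoriality and naturality of the counit are then instances
  of uniqueness, which holds because the second part of a strictly zero-dimensional biframe is
  generated by complements of the first.

  To construct the extension, a congruence \<open>\<theta>\<close> is read as the preorder \<open>x \<le> y\<close> modulo \<open>\<theta>\<close> and
  sent to the join of all \<open>g x \<sqinter> (g y)\<^sup>c\<close> with \<open>x \<le> y\<close> modulo \<open>\<theta>\<close>. This map is a left adjoint, so it
  preserves joins (\<open>ext_le_iff\<close>); it preserves binary meets by distributivity (\<open>ext_meet\<close>).

  If \<open>L\<close> is Noetherian, all joins in \<open>L\<close> are finite, so directed unions of congruences are
  congruences, and the congruence frame is compact (\<open>compact_congruence_frame\<close>). Conversely,
  complemented elements of a compact frame are compact, so the first part of a compact strictly
  zero-dimensional biframe is Noetherian (\<open>noetherian_first_part\<close>). The unit is an isomorphism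
  because \<open>nabla\<close> is injective. The counit is surjective because the total part is generated by the
  first part and its complements. It is injective by compactness: if \<open>x \<le> y\<close> modulo \<open>\<theta>\<close> and the
  counit sends \<open>\<theta>\<close> below its value at \<open>\<phi>\<close>, then the compact element \<open>x\<close> lies below the join of \<open>y\<close>
  and finitely many \<open>b \<sqinter> a\<^sup>c\<close> with \<open>b \<le> a\<close> modulo \<open>\<phi>\<close>, and eliminating these one by one gives
  \<open>x \<le> y\<close> modulo \<open>\<phi>\<close> (\<open>ext_reflects_order\<close>).
\<close>

section \<open>Order and distributivity in frames\<close>

locale frm = frame L for L :: "'a gorder" (structure)
begin

lemma sup_le_iff:
  assumes "S \<subseteq> carrier L" "z \<in> carrier L"
  shows "\<Squnion>S \<sqsubseteq> z \<longleftrightarrow> (\<forall>s\<in>S. s \<sqsubseteq> z)"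
  by (meson assms le_trans subsetD sup_closed sup_least sup_upper)

lemma sup_mono:
  assumes "S \<subseteq> T" "T \<subseteq> carrier L"
  shows "\<Squnion>S \<sqsubseteq> \<Squnion>T"
  using assms by (meson subset_trans subsetD sup_closed sup_least sup_upper)

lemma le_meet_iff:
  "\<lbrakk>x \<in> carrier L; y \<in> carrier L; z \<in> carrier L\<rbrakk> \<Longrightarrow> z \<sqsubseteq> x \<sqinter> y \<longleftrightarrow> z \<sqsubseteq> x \<and> z \<sqsubseteq> y"
  by (meson le_trans meet_closed meet_le meet_left meet_right)

lemma join_le_iff:
  "\<lbrakk>x \<in> carrier L; y \<in> carrier L; z \<in> carrier L\<rbrakk> \<Longrightarrow> x \<squnion> y \<sqsubseteq> z \<longleftrightarrow> x \<sqsubseteq> z \<and> y \<sqsubseteq> z"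
  by (meson le_trans join_closed join_le join_left join_right)

lemma meet_eq_left: "\<lbrakk>x \<in> carrier L; y \<in> carrier L; x \<sqsubseteq> y\<rbrakk> \<Longrightarrow> x \<sqinter> y = x"
  using le_iff_join by metis

lemma meet_idem: "x \<in> carrier L \<Longrightarrow> x \<sqinter> x = x"
  by (simp add: meet_eq_left)

lemma join_idem: "x \<in> carrier L \<Longrightarrow> x \<squnion> x = x"
  by (simp add: join_def)

lemma sup_empty_eq: "\<Squnion>{} = \<bottom>"
  using weak_sup_empty eq_is_equal by simp

lemma sup_insert_eq:
  "\<lbrakk>a \<in> carrier L; A \<subseteq> carrier L\<rbrakk> \<Longrightarrow> \<Squnion>(insert a A) = a \<squnion> \<Squnion>A"
  using weak_sup_insert eq_is_equal by simp

lemma meet_join_distrib: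
  assumes "x \<in> carrier L" "y \<in> carrier L" "z \<in> carrier L"
  shows "x \<sqinter> (y \<squnion> z) = (x \<sqinter> y) \<squnion> (x \<sqinter> z)"
  using inf_sup_distrib[of x "{y, z}"] assms by (simp add: join_def)

lemma join_meet_distrib:
  assumes [simp]: "x \<in> carrier L" "y \<in> carrier L" "z \<in> carrier L"
  shows "(x \<squnion> z) \<sqinter> (y \<squnion> z) \<sqsubseteq> (x \<sqinter> y) \<squnion> z"
proof -
  have z: "(x \<squnion> z) \<sqinter> z \<sqsubseteq> (x \<sqinter> y) \<squnion> z"
    by (meson assms join_closed join_right le_trans meet_closed meet_right)
  have "y \<sqinter> z \<sqsubseteq> (x \<sqinter> y) \<squnion> z"
    by (rule le_trans[OF meet_right join_right]) simp_all
  then have "(x \<squnion> z) \<sqinter> y \<sqsubseteq> (x \<sqinter> y) \<squnion> z"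
    by (simp add: meet_comm[of L "x \<squnion> z" y] meet_join_distrib join_le_iff meet_comm[of L y x] join_left)
  then show ?thesis
    using z by (simp add: meet_join_distrib[of "x \<squnion> z" y z] join_le_iff)
qed

lemma top_meet_eq: "x \<in> carrier L \<Longrightarrow> \<top> \<sqinter> x = x"
  using top_meet eq_is_equal by simp

lemma bottom_join_eq: "x \<in> carrier L \<Longrightarrow> \<bottom> \<squnion> x = x"
  using bottom_join eq_is_equal by simp

text \<open>
  Meeting with a complement of \<open>y\<close> is left adjoint to joining with \<open>y\<close>. Complements are
  eliminated from inequalities in this way.
\<close>

lemma meet_complement_le_iff:
  assumes c: "complement_in L y c" and [simp]: "x \<in> carrier L" "y \<in> carrier L" "n \<in> carrier L"
  shows "x \<sqinter> c \<sqsubseteq> n \<longleftrightarrow> x \<sqsubseteq> y \<squnion> n"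
proof
  have [simp]: "c \<in> carrier L" using c by (simp add: complement_in_def)
  have yc: "y \<sqinter> c = \<bottom>" "y \<squnion> c = \<top>" using c by (auto simp: complement_in_def)
  show "x \<sqsubseteq> y \<squnion> n" if "x \<sqinter> c \<sqsubseteq> n"
  proof -
    have "x = x \<sqinter> (y \<squnion> c)"
      by (simp add: yc meet_eq_left)
    also have "\<dots> = (x \<sqinter> y) \<squnion> (x \<sqinter> c)"
      by (simp add: meet_join_distrib)
    also have "\<dots> \<sqsubseteq> y \<squnion> n"
      using that by (simp add: join_le_iff)
        (meson assms(2-) \<open>c \<in> carrier L\<close> join_closed join_left join_right le_trans meet_closed meet_right)
    finally show ?thesis .
  qed
  show "x \<sqinter> c \<sqsubseteq> n" if "x \<sqsubseteq> y \<squnion> n"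
  proof -
    have "x \<sqinter> c \<sqsubseteq> c \<sqinter> (y \<squnion> n)"
      by (simp add: le_meet_iff meet_right)
        (meson assms(2-) \<open>c \<in> carrier L\<close> join_closed le_trans meet_closed meet_left that)
    also have "c \<sqinter> (y \<squnion> n) = (c \<sqinter> y) \<squnion> (c \<sqinter> n)"
      by (simp add: meet_join_distrib)
    also have "\<dots> \<sqsubseteq> n"
      using yc by (simp add: join_le_iff meet_comm[of L c y] meet_right)
    finally show ?thesis by simp
  qed
qed

lemma complement_unique:
  assumes "complement_in L a c" "complement_in L a d" "a \<in> carrier L"
  shows "c = d"
proof (rule le_antisym)
  have [simp]: "c \<in> carrier L" "d \<in> carrier L" using assms by (auto simp: complement_in_def)
  show "c \<in> carrier L" "d \<in> carrier L" by simp_all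
  show "c \<sqsubseteq> d"
    using meet_complement_le_iff[OF assms(1), of \<top> d] assms by (simp add: complement_in_def top_meet_eq)
  show "d \<sqsubseteq> c"
    using meet_complement_le_iff[OF assms(2), of \<top> c] assms by (simp add: complement_in_def top_meet_eq)
qed

lemma complement_sym: "\<lbrakk>complement_in L a c; a \<in> carrier L\<rbrakk> \<Longrightarrow> complement_in L c a"
  by (auto simp: complement_in_def meet_comm join_comm)

text \<open>
  A finite subcover of \<open>insert y S\<close> may or may not use \<open>y\<close>; adding \<open>y\<close> back is harmless, and the
  rest lies in \<open>S\<close>.
\<close>

lemma compact_le_join_sup:
  assumes x: "compact_element L x" and y: "y \<in> carrier L" and S: "S \<subseteq> carrier L"
    and le: "x \<sqsubseteq> y \<squnion> \<Squnion>S"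
  shows "\<exists>F\<subseteq>S. finite F \<and> x \<sqsubseteq> y \<squnion> \<Squnion>F"
proof -
  have "x \<sqsubseteq> \<Squnion>(insert y S)" using le by (simp only: sup_insert_eq[OF y S])
  moreover have "insert y S \<subseteq> carrier L" using y S by simp
  ultimately obtain F where F: "F \<subseteq> insert y S" "finite F" "x \<sqsubseteq> \<Squnion>F"
    using x unfolding compact_element_def by meson
  obtain G where FG: "F \<subseteq> insert y G" and G: "G \<subseteq> S" "finite G"
    using F by (intro that[of "F - {y}"]) auto
  have GL: "G \<subseteq> carrier L" using G S by auto
  have yG: "insert y G \<subseteq> carrier L" using GL y by simp
  have xL: "x \<in> carrier L" using x by (simp add: compact_element_def)
  have "x \<sqsubseteq> \<Squnion>(insert y G)"
    by (rule le_trans[OF F(3) sup_mono[OF FG yG]])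
      (use subset_trans[OF FG yG] yG xL in \<open>simp_all only: sup_closed\<close>)
  then show ?thesis using G by (auto simp only: sup_insert_eq[OF y GL])
qed

text \<open>A cover of \<open>a\<close> together with the complement of \<open>a\<close> is a cover of the top element.\<close>

lemma compact_complemented:
  assumes top: "compact_element L \<top>" and a: "a \<in> carrier L" and c: "complement_in L a c"
  shows "compact_element L a"
  unfolding compact_element_def
proof (intro conjI allI impI a)
  fix S assume S: "S \<subseteq> carrier L" and le: "a \<sqsubseteq> \<Squnion>S"
  have cc: "c \<in> carrier L" using c by (simp add: complement_in_def)
  have res: "a \<sqsubseteq> n \<longleftrightarrow> \<top> \<sqsubseteq> c \<squnion> n" if "n \<in> carrier L" for n
    using meet_complement_le_iff[OF complement_sym[OF c a], of \<top> n] that a cc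
    by (simp add: top_meet_eq)
  have "\<top> \<sqsubseteq> c \<squnion> \<Squnion>S" using le by (simp only: res[OF sup_closed[OF S]])
  from compact_le_join_sup[OF top cc S this]
  obtain F where F: "F \<subseteq> S" "finite F" "\<top> \<sqsubseteq> c \<squnion> \<Squnion>F" by blast
  then have "a \<sqsubseteq> \<Squnion>F" by (simp only: res[OF sup_closed[OF subset_trans[OF F(1) S]]])
  then show "\<exists>F\<subseteq>S. finite F \<and> a \<sqsubseteq> \<Squnion>F" using F by blast
qed

end

text \<open>
  Left adjoints preserve joins. For the congruence frame this replaces a description of joins of
  congruences by a Heyting implication, which has an explicit formula.
\<close>

lemma frame_of_residuated:
  fixes L (structure)
  assumes "complete_lattice L"
    and res: "\<And>a n. \<lbrakk>a \<in> carrier L; n \<in> carrier L\<rbrakk> \<Longrightarrow>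
      \<exists>r\<in>carrier L. \<forall>s\<in>carrier L. s \<sqsubseteq> r \<longleftrightarrow> a \<sqinter> s \<sqsubseteq> n"
  shows "frame L"
proof -
  interpret complete_lattice L by fact
  show ?thesis
  proof
    fix a S assume a[simp]: "a \<in> carrier L" and S: "S \<subseteq> carrier L"
    let ?T = "(\<lambda>s. a \<sqinter> s) ` S"
    have T: "?T \<subseteq> carrier L" using S by auto
    obtain r where r: "r \<in> carrier L" "\<And>s. s \<in> carrier L \<Longrightarrow> s \<sqsubseteq> r \<longleftrightarrow> a \<sqinter> s \<sqsubseteq> \<Squnion>?T"
      using res[OF a sup_closed[OF T]] by blast
    show "a \<sqinter> \<Squnion>S = \<Squnion>?T"
    proof (rule le_antisym)
      have "\<Squnion>S \<sqsubseteq> r"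
        using S T r by (intro sup_least) (auto simp: subset_iff intro!: sup_upper)
      then show "a \<sqinter> \<Squnion>S \<sqsubseteq> \<Squnion>?T" using r S by simp
      show "\<Squnion>?T \<sqsubseteq> a \<sqinter> \<Squnion>S"
      proof (rule sup_least[OF T])
        show "a \<sqinter> \<Squnion>S \<in> carrier L" using S by simp
        fix t assume "t \<in> ?T"
        then obtain s where s: "s \<in> S" "t = a \<sqinter> s" by blast
        have sL: "s \<in> carrier L" using s S by blast
        have "a \<sqinter> s \<sqsubseteq> \<Squnion>S"
          by (rule le_trans[OF meet_right sup_upper]) (use s sL S in auto)
        then show "t \<sqsubseteq> a \<sqinter> \<Squnion>S"
          using s sL S by (auto intro!: meet_le meet_left)
      qed
    qed (use S T in simp_all)
  qed
qed

section \<open>Frame homomorphisms and subframes\<close>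

locale frm_hom = L: frm L + M: frm M
  for L :: "'a gorder" and M :: "'b gorder" +
  fixes f :: "'a \<Rightarrow> 'b"
  assumes hom: "f \<in> frame_hom L M"
begin

lemma hom_closed [simp]: "x \<in> carrier L \<Longrightarrow> f x \<in> carrier M"
  using hom by (auto simp: frame_hom_def)

lemma hom_image_closed: "S \<subseteq> carrier L \<Longrightarrow> f ` S \<subseteq> carrier M"
  by auto

lemma hom_top [simp]: "f \<top>\<^bsub>L\<^esub> = \<top>\<^bsub>M\<^esub>"
  using hom by (auto simp: frame_hom_def)

lemma hom_meet: "\<lbrakk>x \<in> carrier L; y \<in> carrier L\<rbrakk> \<Longrightarrow> f (x \<sqinter>\<^bsub>L\<^esub> y) = f x \<sqinter>\<^bsub>M\<^esub> f y"
  using hom by (auto simp: frame_hom_def)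

lemma hom_sup: "S \<subseteq> carrier L \<Longrightarrow> f (\<Squnion>\<^bsub>L\<^esub>S) = \<Squnion>\<^bsub>M\<^esub>(f ` S)"
  using hom by (auto simp: frame_hom_def)

lemma hom_bottom [simp]: "f \<bottom>\<^bsub>L\<^esub> = \<bottom>\<^bsub>M\<^esub>"
  using hom_sup[of "{}"] by (simp add: L.sup_empty_eq M.sup_empty_eq)

lemma hom_join: "\<lbrakk>x \<in> carrier L; y \<in> carrier L\<rbrakk> \<Longrightarrow> f (x \<squnion>\<^bsub>L\<^esub> y) = f x \<squnion>\<^bsub>M\<^esub> f y"
  using hom_sup[of "{x, y}"] by (simp add: join_def)

lemma hom_mono: "\<lbrakk>x \<in> carrier L; y \<in> carrier L; x \<sqsubseteq>\<^bsub>L\<^esub> y\<rbrakk> \<Longrightarrow> f x \<sqsubseteq>\<^bsub>M\<^esub> f y"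
  using hom_meet[of x y] M.meet_right[of "f x" "f y"] by (simp add: L.meet_eq_left)

lemma hom_complement:
  "\<lbrakk>a \<in> carrier L; complement_in L a c\<rbrakk> \<Longrightarrow> complement_in M (f a) (f c)"
  unfolding complement_in_def by (metis hom_bottom hom_closed hom_join hom_meet hom_top)

lemma subframe_vimage:
  assumes "subframe M S"
  shows "subframe L {x \<in> carrier L. f x \<in> S}"
proof -
  have sup: "\<Squnion>\<^bsub>M\<^esub>(f ` T) \<in> S" if "T \<subseteq> {x \<in> carrier L. f x \<in> S}" for T
  proof -
    have "f ` T \<subseteq> S" using that by auto
    then show ?thesis using assms by (simp add: subframe_def)
  qed
  have "T \<subseteq> carrier L" if "T \<subseteq> {x \<in> carrier L. f x \<in> S}" for T
    using that by auto
  with sup assms show ?thesis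
    by (auto simp: subframe_def hom_meet hom_sup)
qed

lemma subframe_image:
  assumes S: "subframe L S"
  shows "subframe M (f ` S)"
  unfolding subframe_def
proof (intro conjI ballI allI impI)
  have SL: "S \<subseteq> carrier L" using S by (auto simp: subframe_def)
  then show "f ` S \<subseteq> carrier M" by auto
  show "\<top>\<^bsub>M\<^esub> \<in> f ` S"
    using S by (metis hom_top imageI subframe_def)
  show "a \<sqinter>\<^bsub>M\<^esub> b \<in> f ` S" if ab: "a \<in> f ` S" "b \<in> f ` S" for a b
  proof -
    obtain x y where "x \<in> S" "y \<in> S" "a = f x" "b = f y" using ab by blast
    then show ?thesis
      using S SL hom_meet[of x y] by (metis imageI subframe_def subsetD)
  qed
  show "\<Squnion>\<^bsub>M\<^esub>T \<in> f ` S" if T: "T \<subseteq> f ` S" for T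
  proof -
    obtain U where U: "U \<subseteq> S" "T = f ` U" using T by (auto simp: subset_image_iff)
    then show ?thesis
      using S SL hom_sup[of U] by (metis imageI subframe_def subset_trans)
  qed
qed

end

lemma frm_homI: "\<lbrakk>frame L; frame M; f \<in> frame_hom L M\<rbrakk> \<Longrightarrow> frm_hom L M f"
  by (simp add: frm_hom_def frm_hom_axioms_def frm_def)

lemma frame_homI:
  assumes "\<And>x. x \<in> carrier L \<Longrightarrow> f x \<in> carrier M"
    and "f \<in> extensional (carrier L)"
    and "f \<top>\<^bsub>L\<^esub> = \<top>\<^bsub>M\<^esub>"
    and "\<And>x y. \<lbrakk>x \<in> carrier L; y \<in> carrier L\<rbrakk> \<Longrightarrow> f (x \<sqinter>\<^bsub>L\<^esub> y) = f x \<sqinter>\<^bsub>M\<^esub> f y"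
    and "\<And>S. S \<subseteq> carrier L \<Longrightarrow> f (\<Squnion>\<^bsub>L\<^esub>S) = \<Squnion>\<^bsub>M\<^esub>(f ` S)"
  shows "f \<in> frame_hom L M"
  using assms unfolding frame_hom_def by (auto simp: PiE_iff)

lemma frame_hom_id: "frame L \<Longrightarrow> (\<lambda>x\<in>carrier L. x) \<in> frame_hom L L"
proof -
  assume "frame L"
  then interpret frm L by (simp add: frm_def)
  show ?thesis by (rule frame_homI) (auto simp: subset_iff)
qed

lemma frame_hom_compose:
  assumes "frame L" "frame M" "frame N" "f \<in> frame_hom L M" "g \<in> frame_hom M N"
  shows "compose (carrier L) g f \<in> frame_hom L N"
proof -
  interpret f: frm_hom L M f by (simp add: assms frm_homI)
  interpret g: frm_hom M N g by (simp add: assms frm_homI)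
  show ?thesis
  proof (rule frame_homI)
    fix S assume S: "S \<subseteq> carrier L"
    then have "compose (carrier L) g f ` S = g ` f ` S"
      by (auto simp: compose_def subset_iff image_iff)
    then show "compose (carrier L) g f (\<Squnion>\<^bsub>L\<^esub>S) = \<Squnion>\<^bsub>N\<^esub>(compose (carrier L) g f ` S)"
      using S by (simp add: compose_eq f.hom_sup g.hom_sup f.hom_image_closed)
  qed (simp_all add: compose_def f.hom_meet g.hom_meet)
qed

lemma frame_hom_ext:
  "\<lbrakk>f \<in> frame_hom L M; g \<in> frame_hom L N; \<And>x. x \<in> carrier L \<Longrightarrow> f x = g x\<rbrakk> \<Longrightarrow> f = g"
  unfolding frame_hom_def by (auto simp: PiE_iff intro: extensionalityI)

text \<open>
  Every equation required of the inverse turns, on applying the injective \<open>f\<close>, into one that \<open>f\<close>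
  satisfies.
\<close>

lemma bij_frame_hom_inverse:
  assumes "frame L" "frame M" and f: "f \<in> frame_hom L M"
    and bij: "bij_betw f (carrier L) (carrier M)"
  defines "g \<equiv> \<lambda>y\<in>carrier M. inv_into (carrier L) f y"
  shows "g \<in> frame_hom M L"
    and "compose (carrier L) g f = (\<lambda>x\<in>carrier L. x)"
    and "compose (carrier M) f g = (\<lambda>y\<in>carrier M. y)"
proof -
  interpret f: frm_hom L M f by (simp add: assms frm_homI)
  have gL: "g y \<in> carrier L" if "y \<in> carrier M" for y
    using bij that by (auto simp: g_def bij_betw_def inv_into_into)
  have fg: "f (g y) = y" if "y \<in> carrier M" for y
    using bij that by (auto simp: g_def bij_betw_def f_inv_into_f)
  have gf: "g (f x) = x" if "x \<in> carrier L" for x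
    using bij that by (auto simp: g_def bij_betw_def inv_into_f_f)
  have eqI: "g y = x" if "x \<in> carrier L" "f x = y" for x y
    using gf that by blast
  show "g \<in> frame_hom M L"
  proof (rule frame_homI)
    fix S assume S: "S \<subseteq> carrier M"
    have "f ` g ` S = (\<lambda>y. y) ` S"
      unfolding image_image by (rule image_cong) (use S fg in auto)
    moreover have "g ` S \<subseteq> carrier L" using S gL by auto
    ultimately show "g (\<Squnion>\<^bsub>M\<^esub>S) = \<Squnion>\<^bsub>L\<^esub>(g ` S)"
      by (intro eqI) (simp_all add: f.hom_sup)
  next
    show "g \<in> extensional (carrier M)" by (simp add: g_def)
  next
    show "g (x \<sqinter>\<^bsub>M\<^esub> y) = g x \<sqinter>\<^bsub>L\<^esub> g y" if "x \<in> carrier M" "y \<in> carrier M" for x y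
      using that by (intro eqI) (simp_all add: gL fg f.hom_meet)
  qed (simp_all add: gL eqI)
  show "compose (carrier L) g f = (\<lambda>x\<in>carrier L. x)"
    by (auto simp: compose_def gf)
  show "compose (carrier M) f g = (\<lambda>y\<in>carrier M. y)"
    by (auto simp: compose_def fg)
qed

context frm
begin

lemma subframe_carrier: "subframe L (carrier L)"
  by (auto simp: subframe_def)

lemma subframe_Inter:
  assumes "\<S> \<noteq> {}" "\<And>S. S \<in> \<S> \<Longrightarrow> subframe L S"
  shows "subframe L (\<Inter>\<S>)"
  using assms unfolding subframe_def by (auto simp: le_Inf_iff) blast

lemma subframe_generated:
  assumes "X \<subseteq> carrier L"
  shows "subframe L (generated_subframe L X)"
  unfolding generated_subframe_def
  by (rule subframe_Inter) (use assms subframe_carrier in auto)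

lemma generated_subframe_superset: "X \<subseteq> generated_subframe L X"
  by (auto simp: generated_subframe_def)

lemma generated_subframe_least: "\<lbrakk>subframe L S; X \<subseteq> S\<rbrakk> \<Longrightarrow> generated_subframe L X \<subseteq> S"
  by (auto simp: generated_subframe_def)

lemma generated_subframe_closed: "X \<subseteq> carrier L \<Longrightarrow> generated_subframe L X \<subseteq> carrier L"
  by (rule generated_subframe_least[OF subframe_carrier])

end

lemma frame_hom_eq_on_generated:
  assumes "frame L" "frame M" "f \<in> frame_hom L M" "g \<in> frame_hom L M"
    and eq: "\<And>x. x \<in> X \<Longrightarrow> x \<in> carrier L \<and> f x = g x"
    and x: "x \<in> generated_subframe L X"
  shows "f x = g x"
proof -
  interpret f: frm_hom L M f by (simp add: assms frm_homI)
  interpret g: frm_hom L M g by (simp add: assms frm_homI)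
  have "subframe L {x \<in> carrier L. f x = g x}"
    unfolding subframe_def
  proof (intro conjI ballI allI impI)
    fix T assume T: "T \<subseteq> {x \<in> carrier L. f x = g x}"
    then have "T \<subseteq> carrier L" "f ` T = g ` T" by (auto simp: image_iff subset_iff)
    then show "\<Squnion>\<^bsub>L\<^esub>T \<in> {x \<in> carrier L. f x = g x}" by (simp add: f.hom_sup g.hom_sup)
  qed (auto simp: f.hom_meet g.hom_meet)
  then show ?thesis
    using f.L.generated_subframe_least[of "{x \<in> carrier L. f x = g x}" X] eq x by blast
qed

text \<open>
  The lattice operations are defined by choice, so identifying them takes the uniqueness of least
  and greatest elements.
\<close>

lemma
  fixes L (structure)
  assumes "partial_order L"
  shows sup_eqI: "least L s (Upper L A) \<Longrightarrow> \<Squnion>A = s"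
    and meet_eqI: "greatest L i (Lower L {x, y}) \<Longrightarrow> x \<sqinter> y = i"
    and top_eqI: "greatest L t (carrier L) \<Longrightarrow> \<top> = t"
    and bottom_eqI: "least L b (carrier L) \<Longrightarrow> \<bottom> = b"
proof -
  interpret partial_order L by fact
  show "\<Squnion>A = s" if "least L s (Upper L A)"
    unfolding Lattice.sup_def using that by (blast intro: least_unique someI)
  show "x \<sqinter> y = i" if "greatest L i (Lower L {x, y})"
    unfolding meet_def Lattice.inf_def using that by (blast intro: greatest_unique someI)
  show "\<top> = t" if "greatest L t (carrier L)"
    unfolding top_def using that by (blast intro: greatest_unique someI)
  show "\<bottom> = b" if "least L b (carrier L)"
    unfolding bottom_def using that by (blast intro: least_unique someI)
qed

locale frm_sub = frm +
  fixes S assumes sub: "subframe L S"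
begin

abbreviation "LS \<equiv> L\<lparr>carrier := S\<rparr>"

lemma sub_closed: "x \<in> S \<Longrightarrow> x \<in> carrier L"
  using sub by (auto simp: subframe_def)

lemma sub_sup: "T \<subseteq> S \<Longrightarrow> \<Squnion>T \<in> S"
  using sub by (auto simp: subframe_def)

lemma sub_meet: "\<lbrakk>a \<in> S; b \<in> S\<rbrakk> \<Longrightarrow> a \<sqinter> b \<in> S"
  using sub by (auto simp: subframe_def)

lemma partial_order_sub: "partial_order LS"
proof -
  interpret S: weak_partial_order LS
    by (rule weak_partial_order_subset) (auto simp: sub_closed weak_partial_order_axioms)
  show ?thesis by standard (simp add: eq_is_equal)
qed

lemma least_sub:
  assumes T: "T \<subseteq> S"
  shows "least LS (\<Squnion>T) (Upper LS T)"
proof -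
  interpret S: partial_order LS by (rule partial_order_sub)
  have TL: "T \<subseteq> carrier L" using T sub_closed by auto
  show ?thesis
    by (rule least_UpperI) (use T TL sub_sup sub_closed in \<open>auto simp: sup_upper sup_le_iff Upper_def\<close>)
qed

lemma greatest_sub:
  assumes "x \<in> S" "y \<in> S"
  shows "greatest LS (x \<sqinter> y) (Lower LS {x, y})"
proof -
  interpret S: partial_order LS by (rule partial_order_sub)
  show ?thesis
    by (rule greatest_LowerI)
      (use assms sub_meet sub_closed in \<open>auto simp: le_meet_iff Lower_def meet_left meet_right\<close>)
qed

lemma sup_sub: "T \<subseteq> S \<Longrightarrow> \<Squnion>\<^bsub>LS\<^esub>T = \<Squnion>T"
  by (rule sup_eqI[OF partial_order_sub least_sub])

lemma meet_sub: "\<lbrakk>x \<in> S; y \<in> S\<rbrakk> \<Longrightarrow> x \<sqinter>\<^bsub>LS\<^esub> y = x \<sqinter> y"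
  by (rule meet_eqI[OF partial_order_sub greatest_sub])

lemma top_sub: "\<top>\<^bsub>LS\<^esub> = \<top>"
  by (rule top_eqI[OF partial_order_sub])
    (use sub sub_closed in \<open>auto simp: greatest_def subframe_def\<close>)

lemma frame_sub: "frame LS"
proof -
  interpret S: partial_order LS by (rule partial_order_sub)
  have "complete_lattice LS"
  proof (rule S.complete_latticeI)
    fix A assume "A \<subseteq> carrier LS"
    then have A: "A \<subseteq> S" by simp
    then show "\<exists>s. least LS s (Upper LS A)" using least_sub by blast
    let ?B = "Lower LS A"
    have B: "?B \<subseteq> S" by (auto simp: Lower_def)
    then have BL: "?B \<subseteq> carrier L" using sub_closed by auto
    have "greatest LS (\<Squnion>?B) ?B"
    proof (rule greatest_LowerI)
      fix x assume "x \<in> A"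
      then show "\<Squnion>?B \<sqsubseteq>\<^bsub>LS\<^esub> x"
        using A BL sub_closed by (auto simp: sup_le_iff Lower_def)
    next
      fix y assume "y \<in> ?B" then show "y \<sqsubseteq>\<^bsub>LS\<^esub> \<Squnion>?B" using BL sup_upper by simp
    qed (use A B sub_sup in auto)
    then show "\<exists>i. greatest LS i (Lower LS A)" by blast
  qed
  then interpret S: complete_lattice LS .
  show ?thesis
  proof
    fix a T assume "a \<in> carrier LS" "T \<subseteq> carrier LS"
    then have aT: "a \<in> S" "T \<subseteq> S" by simp_all
    have im: "(\<lambda>s. a \<sqinter>\<^bsub>LS\<^esub> s) ` T = (\<lambda>s. a \<sqinter> s) ` T"
      using aT by (auto simp: meet_sub subset_iff image_iff)
    have "(\<lambda>s. a \<sqinter> s) ` T \<subseteq> S" using aT sub_meet by auto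
    then show "a \<sqinter>\<^bsub>LS\<^esub> \<Squnion>\<^bsub>LS\<^esub>T = \<Squnion>\<^bsub>LS\<^esub>((\<lambda>s. a \<sqinter>\<^bsub>LS\<^esub> s) ` T)"
      unfolding im using aT inf_sup_distrib[of a T] sub_closed sub_sup
      by (simp add: sup_sub meet_sub subset_iff)
  qed
qed

lemma inclusion_hom: "(\<lambda>x\<in>S. x) \<in> frame_hom LS L"
proof (rule frame_homI)
  show "(\<lambda>x\<in>S. x) \<top>\<^bsub>LS\<^esub> = \<top>"
    using sub by (simp add: top_sub subframe_def)
  fix T assume "T \<subseteq> carrier LS"
  then have "T \<subseteq> S" "(\<lambda>x\<in>S. x) ` T = T" by (auto simp: image_iff subset_iff)
  then show "(\<lambda>x\<in>S. x) (\<Squnion>\<^bsub>LS\<^esub>T) = \<Squnion>((\<lambda>x\<in>S. x) ` T)"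
    by (simp add: sup_sub sub_sup)
qed (simp_all add: sub_closed sub_meet meet_sub)

end

section \<open>Congruences as preorders\<close>

text \<open>
  This is \<open>x \<le> y\<close> in the quotient by \<open>\<theta>\<close>. Passing to this relation turns a congruence into a
  preorder that contains the order of the frame and respects finite meets on the right and
  arbitrary joins on the left; conversely \<open>preorder_cong\<close> recovers the congruence. One-sided
  inequalities are much easier to verify than closure of a set of pairs under all operations.
\<close>

definition le_mod :: "'a gorder \<Rightarrow> ('a \<times> 'a) set \<Rightarrow> 'a \<Rightarrow> 'a \<Rightarrow> bool" where
  "le_mod L \<theta> x y \<longleftrightarrow> (x \<sqinter>\<^bsub>L\<^esub> y, x) \<in> \<theta>"

definition frame_preorder :: "'a gorder \<Rightarrow> ('a \<Rightarrow> 'a \<Rightarrow> bool) \<Rightarrow> bool" where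
  "frame_preorder L P \<longleftrightarrow>
     (\<forall>x\<in>carrier L. \<forall>y\<in>carrier L. x \<sqsubseteq>\<^bsub>L\<^esub> y \<longrightarrow> P x y) \<and>
     (\<forall>x\<in>carrier L. \<forall>y\<in>carrier L. \<forall>z\<in>carrier L. P x y \<longrightarrow> P y z \<longrightarrow> P x z) \<and>
     (\<forall>x\<in>carrier L. \<forall>y\<in>carrier L. \<forall>z\<in>carrier L. P z x \<longrightarrow> P z y \<longrightarrow> P z (x \<sqinter>\<^bsub>L\<^esub> y)) \<and>
     (\<forall>S\<subseteq>carrier L. \<forall>z\<in>carrier L. (\<forall>s\<in>S. P s z) \<longrightarrow> P (\<Squnion>\<^bsub>L\<^esub>S) z)"

definition preorder_cong :: "'a gorder \<Rightarrow> ('a \<Rightarrow> 'a \<Rightarrow> bool) \<Rightarrow> ('a \<times> 'a) set" where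
  "preorder_cong L P = {(x, y). x \<in> carrier L \<and> y \<in> carrier L \<and> P x y \<and> P y x}"

lemma frame_preorderI:
  fixes L (structure)
  assumes "\<And>x y. \<lbrakk>x \<in> carrier L; y \<in> carrier L; x \<sqsubseteq> y\<rbrakk> \<Longrightarrow> P x y"
    and "\<And>x y z. \<lbrakk>x \<in> carrier L; y \<in> carrier L; z \<in> carrier L; P x y; P y z\<rbrakk> \<Longrightarrow> P x z"
    and "\<And>x y z. \<lbrakk>x \<in> carrier L; y \<in> carrier L; z \<in> carrier L; P z x; P z y\<rbrakk> \<Longrightarrow> P z (x \<sqinter> y)"
    and "\<And>S z. \<lbrakk>S \<subseteq> carrier L; z \<in> carrier L; \<And>s. s \<in> S \<Longrightarrow> P s z\<rbrakk> \<Longrightarrow> P (\<Squnion>S) z"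
  shows "frame_preorder L P"
  unfolding frame_preorder_def by (intro conjI ballI allI impI) (rule assms; blast)+

lemma frame_preorderD:
  fixes L (structure)
  assumes "frame_preorder L P"
  shows "\<lbrakk>x \<in> carrier L; y \<in> carrier L; x \<sqsubseteq> y\<rbrakk> \<Longrightarrow> P x y"
    and "\<lbrakk>P x y; P y z; x \<in> carrier L; y \<in> carrier L; z \<in> carrier L\<rbrakk> \<Longrightarrow> P x z"
    and "\<lbrakk>P z x; P z y; x \<in> carrier L; y \<in> carrier L; z \<in> carrier L\<rbrakk> \<Longrightarrow> P z (x \<sqinter> y)"
    and "\<lbrakk>\<And>s. s \<in> S \<Longrightarrow> P s z; S \<subseteq> carrier L; z \<in> carrier L\<rbrakk> \<Longrightarrow> P (\<Squnion>S) z"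
proof -
  note c = assms[unfolded frame_preorder_def]
  show "P x y" if "x \<in> carrier L" "y \<in> carrier L" "x \<sqsubseteq> y"
    using c[THEN conjunct1] that by blast
  show "P x z" if "P x y" "P y z" "x \<in> carrier L" "y \<in> carrier L" "z \<in> carrier L"
    using c[THEN conjunct2, THEN conjunct1] that by blast
  show "P z (x \<sqinter> y)" if "P z x" "P z y" "x \<in> carrier L" "y \<in> carrier L" "z \<in> carrier L"
    using c[THEN conjunct2, THEN conjunct2, THEN conjunct1] that by blast
  show "P (\<Squnion>S) z" if "\<And>s. s \<in> S \<Longrightarrow> P s z" "S \<subseteq> carrier L" "z \<in> carrier L"
    using c[THEN conjunct2, THEN conjunct2, THEN conjunct2] that by simp
qed

lemma frame_congruenceD:
  fixes L (structure)
  assumes "frame_congruence L \<theta>"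
  shows "\<theta> \<subseteq> carrier L \<times> carrier L"
    and "x \<in> carrier L \<Longrightarrow> (x, x) \<in> \<theta>"
    and "(x, y) \<in> \<theta> \<Longrightarrow> (y, x) \<in> \<theta>"
    and "\<lbrakk>(x, y) \<in> \<theta>; (y, z) \<in> \<theta>\<rbrakk> \<Longrightarrow> (x, z) \<in> \<theta>"
    and "R \<subseteq> \<theta> \<Longrightarrow> (\<Squnion>(fst ` R), \<Squnion>(snd ` R)) \<in> \<theta>"
proof -
  note c = assms[unfolded frame_congruence_def]
  note e = c[THEN conjunct1] and s = c[THEN conjunct2, THEN conjunct2]
  show "\<theta> \<subseteq> carrier L \<times> carrier L"
    using e by (simp add: equiv_def)
  show "(x, x) \<in> \<theta>" if "x \<in> carrier L"
    using e that by (simp add: equiv_def refl_on_def)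
  show "(y, x) \<in> \<theta>" if "(x, y) \<in> \<theta>"
    using e that by (meson equivE symD)
  show "(x, z) \<in> \<theta>" if "(x, y) \<in> \<theta>" "(y, z) \<in> \<theta>"
    using e that by (meson equivE transD)
  show "(\<Squnion>(fst ` R), \<Squnion>(snd ` R)) \<in> \<theta>" if "R \<subseteq> \<theta>"
    using s that by simp
qed

lemma frame_congruence_meet:
  fixes L (structure)
  assumes "frame_congruence L \<theta>" "(a, b) \<in> \<theta>" "(c, d) \<in> \<theta>"
  shows "(a \<sqinter> c, b \<sqinter> d) \<in> \<theta>"
proof -
  note m = assms(1)[unfolded frame_congruence_def, THEN conjunct2, THEN conjunct1]
  from bspec[OF m assms(2)] have "\<forall>(c, d)\<in>\<theta>. (a \<sqinter> c, b \<sqinter> d) \<in> \<theta>" by simp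
  from bspec[OF this assms(3)] show ?thesis by simp
qed

context frm
begin

lemma frame_congruence_preorder_cong:
  assumes P: "frame_preorder L P"
  shows "frame_congruence L (preorder_cong L P)"
proof -
  note D = frame_preorderD[OF P]
  let ?C = "preorder_cong L P"
  have "equiv (carrier L) ?C"
  proof (rule equivI)
    show "?C \<subseteq> carrier L \<times> carrier L" by (auto simp: preorder_cong_def)
    show "refl_on (carrier L) ?C" by (auto simp: refl_on_def preorder_cong_def D(1))
    show "sym ?C" by (auto simp: sym_on_def preorder_cong_def)
    show "trans ?C" by (auto simp: trans_on_def preorder_cong_def intro: D(2))
  qed
  moreover have "(a \<sqinter> c, b \<sqinter> d) \<in> ?C" if "(a, b) \<in> ?C" "(c, d) \<in> ?C" for a b c d
  proof -
    have m: "P (x \<sqinter> z) (y \<sqinter> w)"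
      if "P x y" "P z w" and [simp]: "x \<in> carrier L" "y \<in> carrier L" "z \<in> carrier L" "w \<in> carrier L"
      for x y z w
    proof (rule D(3))
      show "P (x \<sqinter> z) y" by (rule D(2)[of _ x]) (simp_all add: that meet_left D(1))
      show "P (x \<sqinter> z) w" by (rule D(2)[of _ z]) (simp_all add: that meet_right D(1))
    qed simp_all
    show ?thesis using that by (simp add: preorder_cong_def m)
  qed
  moreover have "(\<Squnion>(fst ` R), \<Squnion>(snd ` R)) \<in> ?C" if R: "R \<subseteq> ?C" for R
  proof -
    have s: "P (\<Squnion>(f ` R)) (\<Squnion>(g ` R))"
      if "\<And>r. r \<in> R \<Longrightarrow> P (f r) (g r)" "f ` R \<subseteq> carrier L" "g ` R \<subseteq> carrier L" for f g
    proof (rule D(4))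
      fix s assume "s \<in> f ` R"
      then obtain r where r: "r \<in> R" "s = f r" by auto
      then have c: "s \<in> carrier L" "g r \<in> carrier L" using that by auto
      show "P s (\<Squnion>(g ` R))"
      proof (rule D(2))
        show "P s (g r)" using that(1) r by simp
        show "P (g r) (\<Squnion>(g ` R))" by (rule D(1)) (use that c r sup_upper in auto)
      qed (use that c in simp_all)
    qed (use that in simp_all)
    have "fst ` R \<subseteq> carrier L" "snd ` R \<subseteq> carrier L"
      "\<And>r. r \<in> R \<Longrightarrow> P (fst r) (snd r)" "\<And>r. r \<in> R \<Longrightarrow> P (snd r) (fst r)"
      using R by (auto simp: preorder_cong_def)
    then show ?thesis by (simp add: preorder_cong_def s)
  qed
  ultimately show ?thesis unfolding frame_congruence_def by blast
qed

lemma frame_preorder_le_mod: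
  assumes "frame_congruence L \<theta>"
  shows "frame_preorder L (le_mod L \<theta>)"
proof (rule frame_preorderI)
  note D = frame_congruenceD[OF assms]
  fix x y assume [simp]: "x \<in> carrier L" "y \<in> carrier L"
  show "le_mod L \<theta> x y" if "x \<sqsubseteq> y"
    using that by (simp add: le_mod_def meet_eq_left D(2))
  fix z assume [simp]: "z \<in> carrier L"
  show "le_mod L \<theta> x z" if xy: "le_mod L \<theta> x y" and yz: "le_mod L \<theta> y z"
  proof -
    have "(x \<sqinter> (y \<sqinter> z), x \<sqinter> y) \<in> \<theta>"
      using yz D(2)[of x] frame_congruence_meet[OF assms] by (simp add: le_mod_def)
    moreover have "((x \<sqinter> y) \<sqinter> z, x \<sqinter> z) \<in> \<theta>"
      using xy D(2)[of z] frame_congruence_meet[OF assms] by (simp add: le_mod_def)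
    ultimately show ?thesis
      using xy D(3,4) unfolding le_mod_def by (metis meet_assoc \<open>x \<in> carrier L\<close> \<open>y \<in> carrier L\<close> \<open>z \<in> carrier L\<close>)
  qed
  show "le_mod L \<theta> z (x \<sqinter> y)" if zx: "le_mod L \<theta> z x" and zy: "le_mod L \<theta> z y"
  proof -
    have "((z \<sqinter> x) \<sqinter> (z \<sqinter> y), z \<sqinter> z) \<in> \<theta>"
      using zx zy frame_congruence_meet[OF assms] by (simp add: le_mod_def)
    moreover have "(z \<sqinter> x) \<sqinter> (z \<sqinter> y) = z \<sqinter> (x \<sqinter> y)"
    proof -
      have "w \<sqsubseteq> (z \<sqinter> x) \<sqinter> (z \<sqinter> y) \<longleftrightarrow> w \<sqsubseteq> z \<sqinter> (x \<sqinter> y)" if "w \<in> carrier L" for w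
        using that by (simp add: le_meet_iff conj_ac)
      from this[of "(z \<sqinter> x) \<sqinter> (z \<sqinter> y)"] this[of "z \<sqinter> (x \<sqinter> y)"]
      show ?thesis by (intro le_antisym) simp_all
    qed
    ultimately show ?thesis by (simp add: le_mod_def meet_idem)
  qed
next
  note D = frame_congruenceD[OF assms]
  fix S z assume S: "S \<subseteq> carrier L" and z: "z \<in> carrier L"
    and le: "\<And>s. s \<in> S \<Longrightarrow> le_mod L \<theta> s z"
  let ?R = "(\<lambda>s. (z \<sqinter> s, s)) ` S"
  have "(\<Squnion>(fst ` ?R), \<Squnion>(snd ` ?R)) \<in> \<theta>"
    using le by (intro D(5)) (auto simp: le_mod_def meet_comm)
  moreover have "\<Squnion>(fst ` ?R) = \<Squnion>S \<sqinter> z"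
    using inf_sup_distrib[OF z S] by (simp add: image_image meet_comm)
  ultimately show "le_mod L \<theta> (\<Squnion>S) z" by (simp add: le_mod_def image_image)
qed

lemma mem_iff_le_mod:
  assumes "frame_congruence L \<theta>"
  shows "(x, y) \<in> \<theta> \<longleftrightarrow> x \<in> carrier L \<and> y \<in> carrier L \<and> le_mod L \<theta> x y \<and> le_mod L \<theta> y x"
proof -
  note D = frame_congruenceD[OF assms]
  have 1: "le_mod L \<theta> u v" if "(u, v) \<in> \<theta>" for u v
  proof -
    have "u \<in> carrier L" using that D(1) by auto
    then show ?thesis
      using frame_congruence_meet[OF assms D(2)[of u] D(3)[OF that]] by (simp add: le_mod_def meet_idem)
  qed
  show ?thesis
  proof
    assume xy: "(x, y) \<in> \<theta>"
    then have "x \<in> carrier L" "y \<in> carrier L" using D(1) by auto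
    then show "x \<in> carrier L \<and> y \<in> carrier L \<and> le_mod L \<theta> x y \<and> le_mod L \<theta> y x"
      using 1[OF xy] 1[OF D(3)[OF xy]] by simp
  next
    assume "x \<in> carrier L \<and> y \<in> carrier L \<and> le_mod L \<theta> x y \<and> le_mod L \<theta> y x"
    then have "(x \<sqinter> y, x) \<in> \<theta>" "(x \<sqinter> y, y) \<in> \<theta>"
      by (simp_all add: le_mod_def meet_comm[of L y x])
    then show "(x, y) \<in> \<theta>" by (rule D(4)[OF D(3)])
  qed
qed

lemma le_mod_preorder_cong:
  assumes P: "frame_preorder L P" and [simp]: "x \<in> carrier L" "y \<in> carrier L"
  shows "le_mod L (preorder_cong L P) x y \<longleftrightarrow> P x y"
proof -
  note D = frame_preorderD[OF P]
  have "P (x \<sqinter> y) x" by (simp add: D(1) meet_left)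
  moreover have "P x (x \<sqinter> y) \<longleftrightarrow> P x y"
  proof
    show "P x (x \<sqinter> y) \<Longrightarrow> P x y" by (rule D(2)[of x "x \<sqinter> y"]) (simp_all add: D(1) meet_right)
    show "P x y \<Longrightarrow> P x (x \<sqinter> y)" by (rule D(3)) (simp_all add: D(1))
  qed
  ultimately show ?thesis by (simp add: le_mod_def preorder_cong_def)
qed

lemma congruence_subset_iff:
  assumes "frame_congruence L \<theta>" "frame_congruence L \<phi>"
  shows "\<theta> \<subseteq> \<phi> \<longleftrightarrow> (\<forall>x\<in>carrier L. \<forall>y\<in>carrier L. le_mod L \<theta> x y \<longrightarrow> le_mod L \<phi> x y)"
proof
  show "\<theta> \<subseteq> \<phi> \<Longrightarrow> \<forall>x\<in>carrier L. \<forall>y\<in>carrier L. le_mod L \<theta> x y \<longrightarrow> le_mod L \<phi> x y"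
    unfolding le_mod_def by blast
  assume le: "\<forall>x\<in>carrier L. \<forall>y\<in>carrier L. le_mod L \<theta> x y \<longrightarrow> le_mod L \<phi> x y"
  show "\<theta> \<subseteq> \<phi>"
  proof (rule subrelI)
    fix x y assume "(x, y) \<in> \<theta>"
    then show "(x, y) \<in> \<phi>" using le by (simp add: mem_iff_le_mod[OF assms(1)] mem_iff_le_mod[OF assms(2)])
  qed
qed

lemmas le_mod_le = frame_preorderD(1)[OF frame_preorder_le_mod]
  and le_mod_trans = frame_preorderD(2)[OF frame_preorder_le_mod]
  and le_mod_meet = frame_preorderD(3)[OF frame_preorder_le_mod]
  and le_mod_sup = frame_preorderD(4)[OF frame_preorder_le_mod]

lemma le_mod_join:
  assumes "frame_congruence L \<theta>" "le_mod L \<theta> x z" "le_mod L \<theta> y z"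
    "x \<in> carrier L" "y \<in> carrier L" "z \<in> carrier L"
  shows "le_mod L \<theta> (x \<squnion> y) z"
proof -
  have "le_mod L \<theta> s z" if "s \<in> {x, y}" for s
    using that assms(2,3) by blast
  then show ?thesis
    unfolding join_def by (rule le_mod_sup[OF assms(1)]) (simp_all add: assms(4-6))
qed

text \<open>
  A cut rule. In the quotient, which is a distributive lattice,
  \<open>x \<le> y \<squnion> a\<close> gives \<open>x = x \<sqinter> (y \<squnion> a) = (x \<sqinter> y) \<squnion> (x \<sqinter> a) \<le> y\<close>.
\<close>

lemma le_mod_cut:
  assumes \<theta>: "frame_congruence L \<theta>"
    and 1: "le_mod L \<theta> x (y \<squnion> a)" and 2: "le_mod L \<theta> (x \<sqinter> a) y"
    and [simp]: "x \<in> carrier L" "y \<in> carrier L" "a \<in> carrier L"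
  shows "le_mod L \<theta> x y"
proof -
  have "le_mod L \<theta> x (x \<sqinter> (y \<squnion> a))"
    by (rule le_mod_meet[OF \<theta>]) (simp_all add: 1 le_mod_le[OF \<theta>])
  moreover have "le_mod L \<theta> (x \<sqinter> (y \<squnion> a)) y"
    by (simp add: meet_join_distrib) (rule le_mod_join[OF \<theta>], simp_all add: 2 le_mod_le[OF \<theta>] meet_right)
  ultimately show ?thesis by (rule le_mod_trans[OF \<theta>]) simp_all
qed

end

context frm
begin

lemma frame_preorder_closed:
  assumes [simp]: "a \<in> carrier L"
  shows "frame_preorder L (\<lambda>x y. x \<sqsubseteq> y \<squnion> a)"
proof (rule frame_preorderI)
  fix x y assume [simp]: "x \<in> carrier L" "y \<in> carrier L"
  show "x \<sqsubseteq> y \<squnion> a" if "x \<sqsubseteq> y"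
    by (rule le_trans[OF that join_left]) simp_all
  fix z assume [simp]: "z \<in> carrier L"
  show "x \<sqsubseteq> z \<squnion> a" if 1: "x \<sqsubseteq> y \<squnion> a" and 2: "y \<sqsubseteq> z \<squnion> a"
    by (rule le_trans[OF 1]) (simp_all add: join_le_iff 2 join_right)
  show "z \<sqsubseteq> (x \<sqinter> y) \<squnion> a" if "z \<sqsubseteq> x \<squnion> a" and "z \<sqsubseteq> y \<squnion> a"
  proof -
    have "z \<sqsubseteq> (x \<squnion> a) \<sqinter> (y \<squnion> a)" using that by (simp add: le_meet_iff)
    then show ?thesis
      by (rule le_trans) (simp_all add: join_meet_distrib)
  qed
next
  fix S z assume "S \<subseteq> carrier L" "z \<in> carrier L" and "\<And>s. s \<in> S \<Longrightarrow> s \<sqsubseteq> z \<squnion> a"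
  then show "\<Squnion>S \<sqsubseteq> z \<squnion> a" by (simp add: sup_le_iff)
qed

lemma frame_preorder_open:
  assumes [simp]: "a \<in> carrier L"
  shows "frame_preorder L (\<lambda>x y. x \<sqinter> a \<sqsubseteq> y)"
proof (rule frame_preorderI)
  fix x y assume [simp]: "x \<in> carrier L" "y \<in> carrier L"
  show "x \<sqinter> a \<sqsubseteq> y" if "x \<sqsubseteq> y"
    by (rule le_trans[OF meet_left that]) simp_all
  fix z assume [simp]: "z \<in> carrier L"
  show "x \<sqinter> a \<sqsubseteq> z" if "x \<sqinter> a \<sqsubseteq> y" and yz: "y \<sqinter> a \<sqsubseteq> z"
    by (rule le_trans[OF _ yz]) (simp_all add: le_meet_iff that meet_right)
  show "z \<sqinter> a \<sqsubseteq> x \<sqinter> y" if "z \<sqinter> a \<sqsubseteq> x" "z \<sqinter> a \<sqsubseteq> y"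
    using that by (simp add: le_meet_iff)
next
  fix S z assume S: "S \<subseteq> carrier L" and [simp]: "z \<in> carrier L" and le: "\<And>s. s \<in> S \<Longrightarrow> s \<sqinter> a \<sqsubseteq> z"
  have "(\<lambda>s. s \<sqinter> a) ` S = (\<lambda>s. a \<sqinter> s) ` S"
    by (rule image_cong) (simp_all add: meet_comm)
  then have "\<Squnion>S \<sqinter> a = \<Squnion>((\<lambda>s. s \<sqinter> a) ` S)"
    using inf_sup_distrib[OF assms S] meet_comm[of L "\<Squnion>S" a] by (simp only:)
  moreover have "\<Squnion>((\<lambda>s. s \<sqinter> a) ` S) \<sqsubseteq> z"
  proof (rule sup_least)
    show "(\<lambda>s. s \<sqinter> a) ` S \<subseteq> carrier L" using S by (intro image_subsetI meet_closed) (use assms in blast)+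
    show "t \<sqsubseteq> z" if "t \<in> (\<lambda>s. s \<sqinter> a) ` S" for t using that le by (elim imageE) simp
  qed simp
  ultimately show "\<Squnion>S \<sqinter> a \<sqsubseteq> z" by (simp only:)
qed

lemma frame_congruence_Inter:
  assumes "\<T> \<noteq> {}" "\<And>\<theta>. \<theta> \<in> \<T> \<Longrightarrow> frame_congruence L \<theta>"
  shows "frame_congruence L (\<Inter>\<T>)"
  unfolding frame_congruence_def
proof (intro conjI allI impI ballI)
  note D = frame_congruenceD[OF assms(2)]
  show "equiv (carrier L) (\<Inter>\<T>)"
  proof (rule equivI)
    show "\<Inter>\<T> \<subseteq> carrier L \<times> carrier L" using assms(1) D(1) by blast
    show "refl_on (carrier L) (\<Inter>\<T>)" using D(2) by (simp add: refl_on_def)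
    show "sym (\<Inter>\<T>)" unfolding sym_on_def using D(3) by (meson InterE InterI)
    show "trans (\<Inter>\<T>)" unfolding trans_on_def using D(4) by (meson InterE InterI)
  qed
  show "(\<Squnion>(fst ` R), \<Squnion>(snd ` R)) \<in> \<Inter>\<T>" if "R \<subseteq> \<Inter>\<T>" for R
    using that by (intro InterI D(5)) (auto simp: le_Inf_iff)
  show "case p of (a, b) \<Rightarrow> \<forall>(c, d)\<in>\<Inter>\<T>. (a \<sqinter> c, b \<sqinter> d) \<in> \<Inter>\<T>" if p: "p \<in> \<Inter>\<T>" for p
  proof (clarsimp split: prod.split)
    fix a b c d \<theta> assume "p = (a, b)" "\<forall>\<theta>\<in>\<T>. (c, d) \<in> \<theta>" "\<theta> \<in> \<T>"
    then show "(a \<sqinter> c, b \<sqinter> d) \<in> \<theta>"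
      using p by (intro frame_congruence_meet[OF assms(2)]) simp_all
  qed
qed

lemma frame_congruence_Int:
  "\<lbrakk>frame_congruence L \<theta>; frame_congruence L \<phi>\<rbrakk> \<Longrightarrow> frame_congruence L (\<theta> \<inter> \<phi>)"
  using frame_congruence_Inter[of "{\<theta>, \<phi>}"] by (metis Inf_insert Inf_empty empty_not_insert inf_top_right insertE singletonD)

lemma le_mod_Int: "le_mod L (\<theta> \<inter> \<phi>) x y \<longleftrightarrow> le_mod L \<theta> x y \<and> le_mod L \<phi> x y"
  by (auto simp: le_mod_def)

lemma frame_congruence_all: "frame_congruence L (carrier L \<times> carrier L)"
  unfolding frame_congruence_def
proof (intro conjI allI impI)
  show "equiv (carrier L) (carrier L \<times> carrier L)"
    by (rule equivI) (auto simp: refl_on_def sym_on_def trans_on_def)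
  fix R assume R: "R \<subseteq> carrier L \<times> carrier L"
  then have "fst ` R \<subseteq> carrier L" "snd ` R \<subseteq> carrier L" by auto
  then show "(\<Squnion>(fst ` R), \<Squnion>(snd ` R)) \<in> carrier L \<times> carrier L" by simp
qed auto

lemma frame_congruence_Id: "frame_congruence L (Id_on (carrier L))"
  unfolding frame_congruence_def
proof (intro conjI allI impI)
  show "equiv (carrier L) (Id_on (carrier L))"
    by (rule equivI) (auto simp: refl_on_def sym_on_def trans_on_def)
  fix R assume R: "R \<subseteq> Id_on (carrier L)"
  then have "fst ` R \<subseteq> carrier L" by auto
  moreover have "snd ` R = fst ` R" using R by (intro image_cong) auto
  ultimately show "(\<Squnion>(fst ` R), \<Squnion>(snd ` R)) \<in> Id_on (carrier L)" by (simp add: Id_on_iff)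
qed auto

lemma frame_congruence_generated:
  assumes "R \<subseteq> carrier L \<times> carrier L"
  shows "frame_congruence L (generated_congruence L R)"
  unfolding generated_congruence_def
  by (rule frame_congruence_Inter) (use assms frame_congruence_all in auto)

lemma generated_congruence_subset_iff:
  "frame_congruence L \<theta> \<Longrightarrow> generated_congruence L R \<subseteq> \<theta> \<longleftrightarrow> R \<subseteq> \<theta>"
  by (auto simp: generated_congruence_def)

lemma congruence_eqI:
  assumes "frame_congruence L \<theta>" "frame_congruence L \<phi>"
    "\<And>x y. \<lbrakk>x \<in> carrier L; y \<in> carrier L\<rbrakk> \<Longrightarrow> le_mod L \<theta> x y \<longleftrightarrow> le_mod L \<phi> x y"
  shows "\<theta> = \<phi>"
  using assms by (intro subset_antisym) (simp_all add: congruence_subset_iff)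

lemma nabla_subset_iff:
  assumes \<theta>: "frame_congruence L \<theta>" and [simp]: "a \<in> carrier L"
  shows "nabla L a \<subseteq> \<theta> \<longleftrightarrow> le_mod L \<theta> a \<bottom>"
  unfolding nabla_def generated_congruence_subset_iff[OF \<theta>]
  by (simp add: mem_iff_le_mod[OF \<theta>] le_mod_le[OF \<theta>])

lemma delta_subset_iff:
  assumes \<theta>: "frame_congruence L \<theta>" and [simp]: "a \<in> carrier L"
  shows "delta L a \<subseteq> \<theta> \<longleftrightarrow> le_mod L \<theta> \<top> a"
  unfolding delta_def generated_congruence_subset_iff[OF \<theta>]
  by (simp add: mem_iff_le_mod[OF \<theta>] le_mod_le[OF \<theta>])

lemma frame_congruence_nabla: "a \<in> carrier L \<Longrightarrow> frame_congruence L (nabla L a)"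
  unfolding nabla_def by (rule frame_congruence_generated) simp

lemma frame_congruence_delta: "a \<in> carrier L \<Longrightarrow> frame_congruence L (delta L a)"
  unfolding delta_def by (rule frame_congruence_generated) simp

lemma le_mod_nabla:
  assumes [simp]: "a \<in> carrier L" "x \<in> carrier L" "y \<in> carrier L"
  shows "le_mod L (nabla L a) x y \<longleftrightarrow> x \<sqsubseteq> y \<squnion> a"
proof
  let ?P = "\<lambda>x y. x \<sqsubseteq> y \<squnion> a"
  note P = frame_preorder_closed[OF assms(1)]
  note N = frame_congruence_nabla[OF assms(1)]
  have "nabla L a \<subseteq> preorder_cong L ?P"
    by (simp add: nabla_subset_iff frame_congruence_preorder_cong P le_mod_preorder_cong[OF P] join_right)
  then show "le_mod L (nabla L a) x y \<Longrightarrow> x \<sqsubseteq> y \<squnion> a"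
    using le_mod_preorder_cong[OF P, of x y] by (auto simp: le_mod_def)
  assume le: "x \<sqsubseteq> y \<squnion> a"
  have "le_mod L (nabla L a) a \<bottom>" using nabla_subset_iff[OF N, of a] by simp
  then have "le_mod L (nabla L a) a y"
    by (rule le_mod_trans[OF N]) (simp_all add: le_mod_le[OF N])
  then have "le_mod L (nabla L a) (y \<squnion> a) y"
    by (intro le_mod_join[OF N]) (simp_all add: le_mod_le[OF N])
  then show "le_mod L (nabla L a) x y"
    by (rule le_mod_trans[OF N le_mod_le[OF N], rotated 3]) (simp_all add: le)
qed

lemma le_mod_delta:
  assumes [simp]: "a \<in> carrier L" "x \<in> carrier L" "y \<in> carrier L"
  shows "le_mod L (delta L a) x y \<longleftrightarrow> x \<sqinter> a \<sqsubseteq> y"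
proof
  let ?P = "\<lambda>x y. x \<sqinter> a \<sqsubseteq> y"
  note P = frame_preorder_open[OF assms(1)]
  note N = frame_congruence_delta[OF assms(1)]
  have "delta L a \<subseteq> preorder_cong L ?P"
    by (simp add: delta_subset_iff frame_congruence_preorder_cong P le_mod_preorder_cong[OF P] meet_right)
  then show "le_mod L (delta L a) x y \<Longrightarrow> x \<sqinter> a \<sqsubseteq> y"
    using le_mod_preorder_cong[OF P, of x y] by (auto simp: le_mod_def)
  assume le: "x \<sqinter> a \<sqsubseteq> y"
  have "le_mod L (delta L a) \<top> a" using delta_subset_iff[OF N, of a] by simp
  then have "le_mod L (delta L a) x a"
    by (rule le_mod_trans[OF N le_mod_le[OF N], rotated 3]) simp_all
  then have "le_mod L (delta L a) x (x \<sqinter> a)"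
    by (intro le_mod_meet[OF N]) (simp_all add: le_mod_le[OF N])
  then show "le_mod L (delta L a) x y"
    by (rule le_mod_trans[OF N]) (simp_all add: le le_mod_le[OF N])
qed

lemma (in frm_hom) frame_preorder_pullback:
  assumes "frame_preorder M P"
  shows "frame_preorder L (\<lambda>x y. P (f x) (f y))"
proof (rule frame_preorderI)
  note D = frame_preorderD[OF assms]
  fix x y assume [simp]: "x \<in> carrier L" "y \<in> carrier L"
  show "P (f x) (f y)" if "x \<sqsubseteq>\<^bsub>L\<^esub> y"
    using that by (intro D(1) hom_mono) simp_all
  fix z assume [simp]: "z \<in> carrier L"
  show "P (f x) (f z)" if "P (f x) (f y)" "P (f y) (f z)"
    by (rule D(2)[OF that]) simp_all
  show "P (f z) (f (x \<sqinter>\<^bsub>L\<^esub> y))" if "P (f z) (f x)" "P (f z) (f y)"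
    using D(3)[OF that] by (simp add: hom_meet)
next
  fix S z assume S: "S \<subseteq> carrier L" and "z \<in> carrier L" and le: "\<And>s. s \<in> S \<Longrightarrow> P (f s) (f z)"
  then show "P (f (\<Squnion>\<^bsub>L\<^esub>S)) (f z)"
    unfolding hom_sup[OF S] by (intro frame_preorderD(4)[OF assms]) (auto simp: hom_image_closed)
qed

text \<open>
  The congruence that forces \<open>x \<le> y\<close> is the meet of a closed and an open one. This is why the
  closed and open congruences together generate all congruences.
\<close>

lemma nabla_Int_delta_subset_iff:
  assumes \<theta>: "frame_congruence L \<theta>" and [simp]: "x \<in> carrier L" "y \<in> carrier L"
  shows "nabla L x \<inter> delta L y \<subseteq> \<theta> \<longleftrightarrow> le_mod L \<theta> x y"
proof
  have ND: "frame_congruence L (nabla L x \<inter> delta L y)"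
    by (simp add: frame_congruence_Int frame_congruence_nabla frame_congruence_delta)
  have "le_mod L (nabla L x \<inter> delta L y) x y"
    by (simp add: le_mod_Int le_mod_nabla le_mod_delta join_right meet_right)
  then show "nabla L x \<inter> delta L y \<subseteq> \<theta> \<Longrightarrow> le_mod L \<theta> x y"
    by (auto simp: le_mod_def)
  assume le: "le_mod L \<theta> x y"
  show "nabla L x \<inter> delta L y \<subseteq> \<theta>"
    unfolding congruence_subset_iff[OF ND \<theta>] le_mod_Int
  proof (intro ballI impI, elim conjE)
    fix u v assume [simp]: "u \<in> carrier L" "v \<in> carrier L"
      and "le_mod L (nabla L x) u v" "le_mod L (delta L y) u v"
    then have ux: "u \<sqsubseteq> v \<squnion> x" and uy: "u \<sqinter> y \<sqsubseteq> v"
      by (simp_all add: le_mod_nabla le_mod_delta)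
    show "le_mod L \<theta> u v"
    proof (rule le_mod_cut[OF \<theta>, where a = x])
      show "le_mod L \<theta> u (v \<squnion> x)" by (simp add: le_mod_le[OF \<theta>] ux)
      have "le_mod L \<theta> (u \<sqinter> x) y"
        by (rule le_mod_trans[OF \<theta> le_mod_le[OF \<theta>] le]) (simp_all add: meet_right)
      then have "le_mod L \<theta> (u \<sqinter> x) (u \<sqinter> y)"
        by (intro le_mod_meet[OF \<theta>]) (simp_all add: le_mod_le[OF \<theta>] meet_left)
      then show "le_mod L \<theta> (u \<sqinter> x) v"
        by (rule le_mod_trans[OF \<theta>]) (simp_all add: le_mod_le[OF \<theta>] uy)
    qed simp_all
  qed
qed

end

section \<open>The congruence frame\<close>

lemma carrier_congruence_frame [simp]: "\<theta> \<in> carrier (congruence_frame L) \<longleftrightarrow> frame_congruence L \<theta>"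
  by (simp add: congruence_frame_def)

lemma le_congruence_frame [simp]: "\<theta> \<sqsubseteq>\<^bsub>congruence_frame L\<^esub> \<phi> \<longleftrightarrow> \<theta> \<subseteq> \<phi>"
  by (simp add: congruence_frame_def)

lemma partial_order_congruence_frame: "partial_order (congruence_frame L)"
  by unfold_locales (auto simp: congruence_frame_def)

context frm
begin

abbreviation "CL \<equiv> congruence_frame L"

lemma complete_lattice_congruence_frame: "complete_lattice CL"
proof -
  interpret C: partial_order CL by (rule partial_order_congruence_frame)
  show ?thesis
  proof (rule C.complete_lattice_criterion1)
    show "\<exists>g. greatest CL g (carrier CL)"
      using frame_congruence_all frame_congruenceD(1)[of L]
      by (intro exI[of _ "carrier L \<times> carrier L"]) (simp add: greatest_def subset_iff[of "carrier CL"])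
    fix A assume A: "A \<subseteq> carrier CL" "A \<noteq> {}"
    then have cong: "frame_congruence L (\<Inter>A)"
      by (intro frame_congruence_Inter) (simp_all add: subset_iff)
    have "greatest CL (\<Inter>A) (Lower CL A)"
    proof (rule greatest_LowerI)
      show "\<Inter>A \<sqsubseteq>\<^bsub>CL\<^esub> \<theta>" if "\<theta> \<in> A" for \<theta> using that by (simp add: Inf_lower)
      show "\<phi> \<sqsubseteq>\<^bsub>CL\<^esub> \<Inter>A" if "\<phi> \<in> Lower CL A" for \<phi>
        using Lower_memD[OF that] A(1) by (simp add: le_Inf_iff subset_iff[of A])
    qed (use A cong in simp_all)
    then show "\<exists>i. greatest CL i (Lower CL A)" by blast
  qed
qed

lemma meet_congruence_frame:
  assumes "frame_congruence L \<theta>" "frame_congruence L \<phi>"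
  shows "\<theta> \<sqinter>\<^bsub>CL\<^esub> \<phi> = \<theta> \<inter> \<phi>"
proof (rule meet_eqI[OF partial_order_congruence_frame])
  show "greatest CL (\<theta> \<inter> \<phi>) (Lower CL {\<theta>, \<phi>})"
    using assms by (auto simp: greatest_def Lower_def frame_congruence_Int)
qed

lemma top_congruence_frame: "\<top>\<^bsub>CL\<^esub> = carrier L \<times> carrier L"
  using frame_congruence_all frame_congruenceD(1)[of L]
  by (intro top_eqI[OF partial_order_congruence_frame]) (simp add: greatest_def subset_iff[of "carrier CL"])

lemma bottom_congruence_frame: "\<bottom>\<^bsub>CL\<^esub> = Id_on (carrier L)"
  using frame_congruence_Id frame_congruenceD(2)[of L]
  by (intro bottom_eqI[OF partial_order_congruence_frame])
    (simp add: least_def subset_iff[of "carrier CL"] subset_iff[of "Id_on (carrier L)"] Id_on_iff)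

text \<open>
  The Heyting implication: \<open>u\<close> lies below \<open>v\<close> modulo \<open>\<theta> \<Rightarrow> \<psi>\<close> iff the meet of \<open>\<theta>\<close> with the principal
  congruence forcing \<open>u \<le> v\<close> is contained in \<open>\<psi>\<close>. Written out on the generators of \<open>\<theta>\<close>, this is
  visibly a preorder of the required kind.
\<close>

lemma frame_preorder_implies:
  assumes \<psi>: "frame_congruence L \<psi>"
  shows "frame_preorder L (\<lambda>u v. \<forall>x\<in>carrier L. \<forall>y\<in>carrier L.
    le_mod L \<theta> x y \<longrightarrow> le_mod L \<psi> (u \<sqinter> x) (v \<squnion> y))"
proof (rule frame_preorderI; intro ballI impI)
  fix u v x y
  assume [simp]: "u \<in> carrier L" "v \<in> carrier L" "x \<in> carrier L" "y \<in> carrier L"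
    and le: "le_mod L \<theta> x y"
  show "le_mod L \<psi> (u \<sqinter> x) (v \<squnion> y)" if "u \<sqsubseteq> v"
  proof (rule le_mod_le[OF \<psi>])
    have "u \<sqinter> x \<sqsubseteq> v" by (rule le_trans[OF meet_left that]) simp_all
    then show "u \<sqinter> x \<sqsubseteq> v \<squnion> y" by (rule le_trans[OF _ join_left]) simp_all
  qed simp_all
  fix w assume [simp]: "w \<in> carrier L"
  show "le_mod L \<psi> (u \<sqinter> x) (w \<squnion> y)"
    if 1: "\<forall>x\<in>carrier L. \<forall>y\<in>carrier L. le_mod L \<theta> x y \<longrightarrow> le_mod L \<psi> (u \<sqinter> x) (v \<squnion> y)"
      and 2: "\<forall>x\<in>carrier L. \<forall>y\<in>carrier L. le_mod L \<theta> x y \<longrightarrow> le_mod L \<psi> (v \<sqinter> x) (w \<squnion> y)"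
  proof (rule le_mod_cut[OF \<psi>, where a = v])
    have yw: "y \<sqsubseteq> w \<squnion> y \<squnion> v" by (rule le_trans[OF join_right join_left]) simp_all
    have "le_mod L \<psi> (u \<sqinter> x) (v \<squnion> y)" using 1 le by simp
    then show "le_mod L \<psi> (u \<sqinter> x) (w \<squnion> y \<squnion> v)"
      by (rule le_mod_trans[OF \<psi>])
        (simp_all add: le_mod_le[OF \<psi>] join_le_iff join_right yw)
    have vx: "le_mod L \<psi> (v \<sqinter> x) (w \<squnion> y)" using 2 le by simp
    have ux: "u \<sqinter> x \<sqinter> v \<sqsubseteq> x" by (rule le_trans[OF meet_left meet_right]) simp_all
    have "le_mod L \<psi> (u \<sqinter> x \<sqinter> v) (v \<sqinter> x)"
      by (rule le_mod_le[OF \<psi>]) (simp_all add: le_meet_iff meet_right ux)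
    then show "le_mod L \<psi> (u \<sqinter> x \<sqinter> v) (w \<squnion> y)"
      by (rule le_mod_trans[OF \<psi> _ vx]) simp_all
  qed simp_all
  show "le_mod L \<psi> (w \<sqinter> x) (u \<sqinter> v \<squnion> y)"
    if 1: "\<forall>x\<in>carrier L. \<forall>y\<in>carrier L. le_mod L \<theta> x y \<longrightarrow> le_mod L \<psi> (w \<sqinter> x) (u \<squnion> y)"
      and 2: "\<forall>x\<in>carrier L. \<forall>y\<in>carrier L. le_mod L \<theta> x y \<longrightarrow> le_mod L \<psi> (w \<sqinter> x) (v \<squnion> y)"
  proof (rule le_mod_trans[OF \<psi>])
    show "le_mod L \<psi> (w \<sqinter> x) ((u \<squnion> y) \<sqinter> (v \<squnion> y))"
      by (rule le_mod_meet[OF \<psi>]) (use 1 2 le in simp_all)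
    show "le_mod L \<psi> ((u \<squnion> y) \<sqinter> (v \<squnion> y)) (u \<sqinter> v \<squnion> y)"
      by (rule le_mod_le[OF \<psi>]) (simp_all add: join_meet_distrib)
  qed simp_all
next
  fix S v x y
  assume S: "S \<subseteq> carrier L" and [simp]: "v \<in> carrier L" "x \<in> carrier L" "y \<in> carrier L"
    and le: "le_mod L \<theta> x y"
    and *: "\<And>s. s \<in> S \<Longrightarrow>
      \<forall>x\<in>carrier L. \<forall>y\<in>carrier L. le_mod L \<theta> x y \<longrightarrow> le_mod L \<psi> (s \<sqinter> x) (v \<squnion> y)"
  have "\<Squnion>S \<sqinter> x = \<Squnion>((\<lambda>s. x \<sqinter> s) ` S)"
    using inf_sup_distrib[of x S] S unfolding meet_comm[of L "\<Squnion>S" x] by simp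
  moreover have "le_mod L \<psi> (\<Squnion>((\<lambda>s. x \<sqinter> s) ` S)) (v \<squnion> y)"
  proof (rule le_mod_sup[OF \<psi>])
    show "(\<lambda>s. x \<sqinter> s) ` S \<subseteq> carrier L"
      by (intro image_subsetI meet_closed) (use S in \<open>simp_all add: subset_iff\<close>)
    fix t assume "t \<in> (\<lambda>s. x \<sqinter> s) ` S"
    then obtain s where s: "s \<in> S" "t = s \<sqinter> x" using meet_comm[of L x] by blast
    then show "le_mod L \<psi> t (v \<squnion> y)" using * le by simp
  qed simp_all
  ultimately show "le_mod L \<psi> (\<Squnion>S \<sqinter> x) (v \<squnion> y)" by simp
qed

lemma frame_congruence_frame: "frame CL"
proof (rule frame_of_residuated[OF complete_lattice_congruence_frame])
  fix \<theta> \<psi> assume "\<theta> \<in> carrier CL" "\<psi> \<in> carrier CL"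
  then have \<theta>: "frame_congruence L \<theta>" and \<psi>: "frame_congruence L \<psi>" by simp_all
  let ?P = "\<lambda>u v. \<forall>x\<in>carrier L. \<forall>y\<in>carrier L.
    le_mod L \<theta> x y \<longrightarrow> le_mod L \<psi> (u \<sqinter> x) (v \<squnion> y)"
  note P = frame_preorder_implies[OF \<psi>, of \<theta>]
  let ?r = "preorder_cong L ?P"
  have r: "frame_congruence L ?r" by (rule frame_congruence_preorder_cong[OF P])
  have le_r: "le_mod L ?r u v \<longleftrightarrow> ?P u v" if "u \<in> carrier L" "v \<in> carrier L" for u v
    by (rule le_mod_preorder_cong[OF P that])
  have "\<phi> \<subseteq> ?r \<longleftrightarrow> \<theta> \<inter> \<phi> \<subseteq> \<psi>" if \<phi>: "frame_congruence L \<phi>" for \<phi>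
  proof
    note Int = frame_congruence_Int[OF \<theta> \<phi>]
    assume sub: "\<phi> \<subseteq> ?r"
    show "\<theta> \<inter> \<phi> \<subseteq> \<psi>"
      unfolding congruence_subset_iff[OF Int \<psi>] le_mod_Int
    proof (intro ballI impI, elim conjE)
      fix u v assume uv: "u \<in> carrier L" "v \<in> carrier L" and le: "le_mod L \<theta> u v" "le_mod L \<phi> u v"
      have "?P u v"
        using sub le(2) uv unfolding congruence_subset_iff[OF \<phi> r] le_r[OF uv, symmetric] by blast
      then have "le_mod L \<psi> (u \<sqinter> u) (v \<squnion> v)" using uv le(1) by simp
      then show "le_mod L \<psi> u v"
        using uv by (simp add: meet_idem join_idem)
    qed
  next
    note Int = frame_congruence_Int[OF \<theta> \<phi>]
    assume sub: "\<theta> \<inter> \<phi> \<subseteq> \<psi>"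
    show "\<phi> \<subseteq> ?r"
      unfolding congruence_subset_iff[OF \<phi> r]
    proof (intro ballI impI)
      fix u v assume [simp]: "u \<in> carrier L" "v \<in> carrier L" and uv: "le_mod L \<phi> u v"
      have "le_mod L \<psi> (u \<sqinter> x) (v \<squnion> y)"
        if [simp]: "x \<in> carrier L" "y \<in> carrier L" and xy: "le_mod L \<theta> x y" for x y
      proof -
        have "le_mod L \<theta> (u \<sqinter> x) y"
          by (rule le_mod_trans[OF \<theta> _ xy]) (simp_all add: le_mod_le[OF \<theta>] meet_right)
        then have 1: "le_mod L \<theta> (u \<sqinter> x) (v \<squnion> y)"
          by (rule le_mod_trans[OF \<theta>]) (simp_all add: le_mod_le[OF \<theta>] join_right)
        have "le_mod L \<phi> (u \<sqinter> x) v"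
          by (rule le_mod_trans[OF \<phi> _ uv]) (simp_all add: le_mod_le[OF \<phi>] meet_left)
        then have 2: "le_mod L \<phi> (u \<sqinter> x) (v \<squnion> y)"
          by (rule le_mod_trans[OF \<phi>]) (simp_all add: le_mod_le[OF \<phi>] join_left)
        show ?thesis
          using sub 1 2 unfolding congruence_subset_iff[OF Int \<psi>] le_mod_Int by simp
      qed
      then show "le_mod L ?r u v" by (simp add: le_r)
    qed
  qed
  then show "\<exists>r\<in>carrier CL. \<forall>\<phi>\<in>carrier CL.
      \<phi> \<sqsubseteq>\<^bsub>CL\<^esub> r \<longleftrightarrow> \<theta> \<sqinter>\<^bsub>CL\<^esub> \<phi> \<sqsubseteq>\<^bsub>CL\<^esub> \<psi>"
    using r \<theta> by (intro bexI[of _ ?r]) (simp_all add: meet_congruence_frame)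
qed

lemma frm_congruence_frame: "frm CL"
  using frame_congruence_frame by (simp add: frm_def)

interpretation C: frm CL
  by (rule frm_congruence_frame)

lemma sup_subset_iff:
  assumes "S \<subseteq> carrier CL" "frame_congruence L \<theta>"
  shows "\<Squnion>\<^bsub>CL\<^esub>S \<subseteq> \<theta> \<longleftrightarrow> (\<forall>\<phi>\<in>S. \<phi> \<subseteq> \<theta>)"
  using C.sup_le_iff[of S \<theta>] assms by simp

lemma top_subset_iff:
  assumes \<theta>: "frame_congruence L \<theta>"
  shows "\<theta> = carrier L \<times> carrier L \<longleftrightarrow> le_mod L \<theta> \<top> \<bottom>"
proof
  show "\<theta> = carrier L \<times> carrier L \<Longrightarrow> le_mod L \<theta> \<top> \<bottom>" by (simp add: le_mod_def)
  assume le: "le_mod L \<theta> \<top> \<bottom>"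
  have "le_mod L \<theta> x y" if "x \<in> carrier L" "y \<in> carrier L" for x y
  proof (rule le_mod_trans[OF \<theta>, of _ \<top>])
    show "le_mod L \<theta> \<top> y"
      by (rule le_mod_trans[OF \<theta> le]) (simp_all add: le_mod_le[OF \<theta>] that)
  qed (simp_all add: le_mod_le[OF \<theta>] that)
  then have "carrier L \<times> carrier L \<subseteq> \<theta>"
    by (intro subrelI) (simp add: mem_iff_le_mod[OF \<theta>])
  with frame_congruenceD(1)[OF \<theta>] show "\<theta> = carrier L \<times> carrier L" by (rule subset_antisym)
qed

lemma nabla_delta_complement:
  assumes [simp]: "a \<in> carrier L"
  shows "complement_in CL (nabla L a) (delta L a)"
  unfolding complement_in_def
proof (intro conjI)
  note N = frame_congruence_nabla[OF assms] and D = frame_congruence_delta[OF assms]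
  note [simp] = N D
  show "delta L a \<in> carrier CL" by simp
  have "nabla L a \<inter> delta L a \<subseteq> Id_on (carrier L)"
    by (simp add: nabla_Int_delta_subset_iff frame_congruence_Id le_mod_le)
  moreover have "Id_on (carrier L) \<subseteq> nabla L a \<inter> delta L a"
    using frame_congruenceD(2)[OF N] frame_congruenceD(2)[OF D] by (simp add: subset_iff Id_on_iff)
  ultimately show "nabla L a \<sqinter>\<^bsub>CL\<^esub> delta L a = \<bottom>\<^bsub>CL\<^esub>"
    unfolding bottom_congruence_frame meet_congruence_frame[OF N D] by (rule subset_antisym)
  let ?j = "nabla L a \<squnion>\<^bsub>CL\<^esub> delta L a"
  have jc: "?j \<in> carrier CL" by (rule C.join_closed) simp_all
  then have J: "frame_congruence L ?j" by simp
  have "nabla L a \<subseteq> ?j" "delta L a \<subseteq> ?j"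
    using C.join_left[of "nabla L a" "delta L a"] C.join_right[of "nabla L a" "delta L a"] by simp_all
  then have b: "le_mod L ?j a \<bottom>" and t: "le_mod L ?j \<top> a"
    by (simp_all add: nabla_subset_iff[OF J] delta_subset_iff[OF J])
  have "le_mod L ?j \<top> \<bottom>" by (rule le_mod_trans[OF J t b]) simp_all
  then show "?j = \<top>\<^bsub>CL\<^esub>"
    unfolding top_congruence_frame by (simp only: top_subset_iff[OF J])
qed

lemma nabla_subset_nabla_iff:
  assumes "a \<in> carrier L" "b \<in> carrier L"
  shows "nabla L a \<subseteq> nabla L b \<longleftrightarrow> a \<sqsubseteq> b"
  using assms by (simp add: nabla_subset_iff frame_congruence_nabla le_mod_nabla bottom_join_eq)

lemma inj_on_nabla: "inj_on (nabla L) (carrier L)"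
proof (rule inj_onI)
  fix a b assume "a \<in> carrier L" "b \<in> carrier L" "nabla L a = nabla L b"
  then show "a = b"
    using nabla_subset_nabla_iff[of a b] nabla_subset_nabla_iff[of b a] by (simp add: le_antisym)
qed

lemma unit_hom: "unit L \<in> frame_hom L CL"
proof (rule frame_homI)
  show "unit L x \<in> carrier CL" if "x \<in> carrier L" for x
    using that by (simp add: unit_def frame_congruence_nabla)
  show "unit L \<in> extensional (carrier L)" by (simp add: unit_def)
  show "unit L \<top> = \<top>\<^bsub>CL\<^esub>"
    unfolding top_congruence_frame unit_def
    by (simp add: top_subset_iff frame_congruence_nabla le_mod_nabla join_right)
  show "unit L (x \<sqinter> y) = unit L x \<sqinter>\<^bsub>CL\<^esub> unit L y" if [simp]: "x \<in> carrier L" "y \<in> carrier L" for x y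
  proof -
    have "nabla L (x \<sqinter> y) = nabla L x \<inter> nabla L y"
    proof (rule congruence_eqI)
      fix u v assume [simp]: "u \<in> carrier L" "v \<in> carrier L"
      have "u \<sqsubseteq> v \<squnion> x \<sqinter> y \<longleftrightarrow> u \<sqsubseteq> v \<squnion> x \<and> u \<sqsubseteq> v \<squnion> y"
      proof
        assume u: "u \<sqsubseteq> v \<squnion> x \<sqinter> y"
        show "u \<sqsubseteq> v \<squnion> x \<and> u \<sqsubseteq> v \<squnion> y"
        proof (intro conjI; rule le_trans[OF u])
          show "v \<squnion> x \<sqinter> y \<sqsubseteq> v \<squnion> x"
            by (simp add: join_le_iff join_left) (rule le_trans[OF meet_left join_right]; simp)
          show "v \<squnion> x \<sqinter> y \<sqsubseteq> v \<squnion> y"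
            by (simp add: join_le_iff join_left) (rule le_trans[OF meet_right join_right]; simp)
        qed simp_all
      next
        assume "u \<sqsubseteq> v \<squnion> x \<and> u \<sqsubseteq> v \<squnion> y"
        then have "u \<sqsubseteq> (x \<squnion> v) \<sqinter> (y \<squnion> v)" by (simp add: le_meet_iff join_comm)
        then have "u \<sqsubseteq> x \<sqinter> y \<squnion> v"
          by (rule le_trans) (simp_all add: join_meet_distrib)
        then show "u \<sqsubseteq> v \<squnion> x \<sqinter> y" by (simp add: join_comm[of L v])
      qed
      then show "le_mod L (nabla L (x \<sqinter> y)) u v \<longleftrightarrow> le_mod L (nabla L x \<inter> nabla L y) u v"
        by (simp add: le_mod_Int le_mod_nabla)
    qed (simp_all add: frame_congruence_nabla frame_congruence_Int)
    then show ?thesis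
      by (simp add: unit_def meet_congruence_frame frame_congruence_nabla)
  qed
  fix S assume S: "S \<subseteq> carrier L"
  then have SL: "s \<in> carrier L" if "s \<in> S" for s using that by blast
  have im: "unit L ` S = nabla L ` S"
    by (rule image_cong) (simp_all add: unit_def SL)
  have imC: "nabla L ` S \<subseteq> carrier CL"
    by (rule image_subsetI) (simp add: frame_congruence_nabla SL)
  then have J: "frame_congruence L (\<Squnion>\<^bsub>CL\<^esub>(nabla L ` S))"
    using C.sup_closed[OF imC] by simp
  have "nabla L (\<Squnion>S) \<subseteq> \<Squnion>\<^bsub>CL\<^esub>(nabla L ` S)"
    unfolding nabla_subset_iff[OF J sup_closed[OF S]]
  proof (rule le_mod_sup[OF J _ S])
    fix s assume s: "s \<in> S"
    have "nabla L s \<subseteq> \<Squnion>\<^bsub>CL\<^esub>(nabla L ` S)"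
      using C.sup_upper[OF imC, of "nabla L s"] s by simp
    then show "le_mod L (\<Squnion>\<^bsub>CL\<^esub>(nabla L ` S)) s \<bottom>"
      unfolding nabla_subset_iff[OF J SL[OF s]] .
  qed simp
  moreover have "\<Squnion>\<^bsub>CL\<^esub>(nabla L ` S) \<subseteq> nabla L (\<Squnion>S)"
    unfolding sup_subset_iff[OF imC frame_congruence_nabla[OF sup_closed[OF S]]]
    using S by (simp add: nabla_subset_nabla_iff SL sup_upper)
  ultimately show "unit L (\<Squnion>S) = \<Squnion>\<^bsub>CL\<^esub>(unit L ` S)"
    unfolding im using S by (simp add: unit_def)
qed

lemma congruence_eq_sup:
  assumes \<theta>: "frame_congruence L \<theta>"
  defines "G \<equiv> {nabla L x \<sqinter>\<^bsub>CL\<^esub> delta L y | x y. x \<in> carrier L \<and> y \<in> carrier L \<and> le_mod L \<theta> x y}"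
  shows "G \<subseteq> carrier CL" and "\<theta> = \<Squnion>\<^bsub>CL\<^esub>G"
proof -
  have GE: "\<exists>x y. g = nabla L x \<inter> delta L y \<and> x \<in> carrier L \<and> y \<in> carrier L \<and> le_mod L \<theta> x y"
    if "g \<in> G" for g
    using that meet_congruence_frame[OF frame_congruence_nabla frame_congruence_delta]
    unfolding G_def by blast
  show GC: "G \<subseteq> carrier CL"
  proof
    fix g assume "g \<in> G"
    from GE[OF this] show "g \<in> carrier CL"
      by (auto simp: frame_congruence_Int frame_congruence_nabla frame_congruence_delta)
  qed
  then have J: "frame_congruence L (\<Squnion>\<^bsub>CL\<^esub>G)" using C.sup_closed[OF GC] by simp
  show "\<theta> = \<Squnion>\<^bsub>CL\<^esub>G"
  proof (rule subset_antisym)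
    show "\<theta> \<subseteq> \<Squnion>\<^bsub>CL\<^esub>G"
      unfolding congruence_subset_iff[OF \<theta> J]
    proof (intro ballI impI)
      fix x y assume xy: "x \<in> carrier L" "y \<in> carrier L" and "le_mod L \<theta> x y"
      then have "nabla L x \<sqinter>\<^bsub>CL\<^esub> delta L y \<in> G" unfolding G_def by blast
      then have "nabla L x \<inter> delta L y \<subseteq> \<Squnion>\<^bsub>CL\<^esub>G"
        using C.sup_upper[OF GC] xy
        by (simp add: meet_congruence_frame frame_congruence_nabla frame_congruence_delta)
      then show "le_mod L (\<Squnion>\<^bsub>CL\<^esub>G) x y"
        unfolding nabla_Int_delta_subset_iff[OF J xy] .
    qed
    show "\<Squnion>\<^bsub>CL\<^esub>G \<subseteq> \<theta>"
      unfolding sup_subset_iff[OF GC \<theta>]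
    proof
      fix g assume "g \<in> G"
      from GE[OF this] show "g \<subseteq> \<theta>" using nabla_Int_delta_subset_iff[OF \<theta>] by blast
    qed
  qed
qed

end

section \<open>The universal property of the congruence frame\<close>

definition complement_of :: "'a gorder \<Rightarrow> 'a \<Rightarrow> 'a" where
  "complement_of L a = (SOME c. complement_in L a c)"

text \<open>
  The congruence forcing \<open>x \<le> y\<close> is the meet of \<open>nabla L x\<close> and the complement of \<open>nabla L y\<close>, and
  \<open>\<theta>\<close> is the join of those that hold modulo it. A homomorphism that sends \<open>nabla L a\<close> to \<open>g a\<close> can
  only be given by this formula.
\<close>

definition cong_extend :: "'a gorder \<Rightarrow> 'b gorder \<Rightarrow> ('a \<Rightarrow> 'b) \<Rightarrow> ('a \<times> 'a) set \<Rightarrow> 'b" where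
  "cong_extend L N g = (\<lambda>\<theta>\<in>carrier (congruence_frame L).
     \<Squnion>\<^bsub>N\<^esub>{g x \<sqinter>\<^bsub>N\<^esub> complement_of N (g y) | x y.
       x \<in> carrier L \<and> y \<in> carrier L \<and> le_mod L \<theta> x y})"

locale complemented_hom = frm_hom L N g
  for L :: "'a gorder" and N :: "'b gorder" and g +
  assumes complemented: "a \<in> carrier L \<Longrightarrow> \<exists>c. complement_in N (g a) c"
begin

abbreviation "cpl a \<equiv> complement_of N (g a)"
abbreviation "ext \<equiv> cong_extend L N g"
abbreviation "pieces \<theta> \<equiv> {g x \<sqinter>\<^bsub>N\<^esub> cpl y | x y.
  x \<in> carrier L \<and> y \<in> carrier L \<and> le_mod L \<theta> x y}"

lemma cpl: "a \<in> carrier L \<Longrightarrow> complement_in N (g a) (cpl a)"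
  unfolding complement_of_def by (rule someI_ex[OF complemented])

lemma cpl_closed [simp]: "a \<in> carrier L \<Longrightarrow> cpl a \<in> carrier N"
  using cpl by (simp add: complement_in_def)

lemma pieces_closed: "pieces \<theta> \<subseteq> carrier N"
  using M.meet_closed[OF hom_closed cpl_closed] by blast

lemma ext_closed: "frame_congruence L \<theta> \<Longrightarrow> ext \<theta> \<in> carrier N"
  by (simp add: cong_extend_def M.sup_closed[OF pieces_closed])

lemma piece_le_ext:
  assumes "frame_congruence L \<theta>" "x \<in> carrier L" "y \<in> carrier L" "le_mod L \<theta> x y"
  shows "g x \<sqinter>\<^bsub>N\<^esub> cpl y \<sqsubseteq>\<^bsub>N\<^esub> ext \<theta>"
proof -
  have "g x \<sqinter>\<^bsub>N\<^esub> cpl y \<in> pieces \<theta>" using assms by blast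
  then have "g x \<sqinter>\<^bsub>N\<^esub> cpl y \<sqsubseteq>\<^bsub>N\<^esub> \<Squnion>\<^bsub>N\<^esub>(pieces \<theta>)"
    by (rule M.sup_upper[OF pieces_closed])
  then show ?thesis using assms(1) by (simp add: cong_extend_def)
qed

text \<open>
  The extension is a left adjoint: its right adjoint sends \<open>n\<close> to the congruence of all pairs
  identified by \<open>g\<close> modulo the closed congruence of \<open>n\<close>.
\<close>

lemma ext_le_iff:
  assumes \<theta>: "frame_congruence L \<theta>" and [simp]: "n \<in> carrier N"
  shows "ext \<theta> \<sqsubseteq>\<^bsub>N\<^esub> n \<longleftrightarrow> \<theta> \<subseteq> preorder_cong L (\<lambda>x y. g x \<sqsubseteq>\<^bsub>N\<^esub> g y \<squnion>\<^bsub>N\<^esub> n)"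
proof -
  note P = frame_preorder_pullback[OF M.frame_preorder_closed[of n], simplified]
  have "ext \<theta> \<sqsubseteq>\<^bsub>N\<^esub> n \<longleftrightarrow> (\<forall>p\<in>pieces \<theta>. p \<sqsubseteq>\<^bsub>N\<^esub> n)"
    using \<theta> by (simp add: cong_extend_def M.sup_le_iff[OF pieces_closed] del: mem_Collect_eq)
  also have "\<dots> \<longleftrightarrow> (\<forall>x\<in>carrier L. \<forall>y\<in>carrier L. le_mod L \<theta> x y \<longrightarrow> g x \<sqinter>\<^bsub>N\<^esub> cpl y \<sqsubseteq>\<^bsub>N\<^esub> n)"
    by blast
  also have "\<dots> \<longleftrightarrow> (\<forall>x\<in>carrier L. \<forall>y\<in>carrier L. le_mod L \<theta> x y \<longrightarrow> g x \<sqsubseteq>\<^bsub>N\<^esub> g y \<squnion>\<^bsub>N\<^esub> n)"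
    by (simp add: M.meet_complement_le_iff[OF cpl])
  also have "\<dots> \<longleftrightarrow> \<theta> \<subseteq> preorder_cong L (\<lambda>x y. g x \<sqsubseteq>\<^bsub>N\<^esub> g y \<squnion>\<^bsub>N\<^esub> n)"
    unfolding L.congruence_subset_iff[OF \<theta> L.frame_congruence_preorder_cong[OF P]]
    by (simp add: L.le_mod_preorder_cong[OF P])
  finally show ?thesis .
qed

lemma ext_mono:
  assumes \<theta>: "frame_congruence L \<theta>" and \<phi>: "frame_congruence L \<phi>" and sub: "\<theta> \<subseteq> \<phi>"
  shows "ext \<theta> \<sqsubseteq>\<^bsub>N\<^esub> ext \<phi>"
proof -
  have "\<phi> \<subseteq> preorder_cong L (\<lambda>x y. g x \<sqsubseteq>\<^bsub>N\<^esub> g y \<squnion>\<^bsub>N\<^esub> ext \<phi>)"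
    using ext_le_iff[OF \<phi> ext_closed[OF \<phi>]] ext_closed[OF \<phi>] by simp
  with sub show ?thesis
    unfolding ext_le_iff[OF \<theta> ext_closed[OF \<phi>]] by (rule subset_trans)
qed

lemma ext_sup:
  assumes S: "S \<subseteq> carrier (congruence_frame L)"
  shows "ext (\<Squnion>\<^bsub>congruence_frame L\<^esub>S) = \<Squnion>\<^bsub>N\<^esub>(ext ` S)"
proof -
  interpret C: frm "congruence_frame L" by (rule L.frm_congruence_frame)
  let ?J = "\<Squnion>\<^bsub>congruence_frame L\<^esub>S"
  have J: "frame_congruence L ?J" using C.sup_closed[OF S] by simp
  have cong: "frame_congruence L \<theta>" if "\<theta> \<in> S" for \<theta>
    using subsetD[OF S that] by simp
  have im: "ext ` S \<subseteq> carrier N"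
    by (intro image_subsetI ext_closed cong)
  show ?thesis
  proof (rule M.le_antisym)
    show c: "ext ?J \<in> carrier N" "\<Squnion>\<^bsub>N\<^esub>(ext ` S) \<in> carrier N"
      by (simp_all add: ext_closed J M.sup_closed[OF im])
    let ?n = "\<Squnion>\<^bsub>N\<^esub>(ext ` S)"
    note P = frame_preorder_pullback[OF M.frame_preorder_closed[OF c(2)]]
    show "ext ?J \<sqsubseteq>\<^bsub>N\<^esub> ?n"
      unfolding ext_le_iff[OF J c(2)] L.sup_subset_iff[OF S L.frame_congruence_preorder_cong[OF P]]
    proof
      fix \<theta> assume \<theta>: "\<theta> \<in> S"
      then have "ext \<theta> \<sqsubseteq>\<^bsub>N\<^esub> ?n" by (intro M.sup_upper[OF im] imageI)
      then show "\<theta> \<subseteq> preorder_cong L (\<lambda>x y. g x \<sqsubseteq>\<^bsub>N\<^esub> g y \<squnion>\<^bsub>N\<^esub> ?n)"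
        unfolding ext_le_iff[OF cong[OF \<theta>] c(2)] .
    qed
    show "?n \<sqsubseteq>\<^bsub>N\<^esub> ext ?J"
    proof (rule M.sup_least[OF im c(1)])
      fix t assume "t \<in> ext ` S"
      then obtain \<theta> where \<theta>: "\<theta> \<in> S" "t = ext \<theta>" by blast
      have "\<theta> \<subseteq> ?J" using C.sup_upper[OF S \<theta>(1)] by simp
      then show "t \<sqsubseteq>\<^bsub>N\<^esub> ext ?J" unfolding \<theta>(2) by (rule ext_mono[OF cong[OF \<theta>(1)] J])
    qed
  qed
qed

lemma ext_nabla:
  assumes [simp]: "a \<in> carrier L"
  shows "ext (nabla L a) = g a"
proof (rule M.le_antisym)
  note N = L.frame_congruence_nabla[OF assms]
  note P = frame_preorder_pullback[OF M.frame_preorder_closed[of "g a"], simplified]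
  show "ext (nabla L a) \<in> carrier N" by (rule ext_closed[OF N])
  show "ext (nabla L a) \<sqsubseteq>\<^bsub>N\<^esub> g a"
    by (simp add: ext_le_iff[OF N] L.nabla_subset_iff L.frame_congruence_preorder_cong[OF P]
        L.le_mod_preorder_cong[OF P] M.join_right)
  have "le_mod L (nabla L a) a \<bottom>\<^bsub>L\<^esub>" using L.nabla_subset_iff[OF N, of a] by simp
  then have "g a \<sqinter>\<^bsub>N\<^esub> cpl \<bottom>\<^bsub>L\<^esub> \<sqsubseteq>\<^bsub>N\<^esub> ext (nabla L a)" by (intro piece_le_ext N) simp_all
  then have "g a \<sqsubseteq>\<^bsub>N\<^esub> g \<bottom>\<^bsub>L\<^esub> \<squnion>\<^bsub>N\<^esub> ext (nabla L a)"
    using M.meet_complement_le_iff[OF cpl, of "\<bottom>\<^bsub>L\<^esub>" "g a" "ext (nabla L a)"] ext_closed[OF N] by simp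
  then show "g a \<sqsubseteq>\<^bsub>N\<^esub> ext (nabla L a)"
    using ext_closed[OF N] by (simp add: M.bottom_join_eq)
qed simp

text \<open>
  By distributivity it is enough to meet two pieces. The meet of those for \<open>(x, y)\<close> and \<open>(u, v)\<close> is
  the piece for \<open>(x \<sqinter> u, y \<squnion> v)\<close>, an inequality that holds modulo both congruences.
\<close>

lemma ext_meet:
  assumes \<theta>: "frame_congruence L \<theta>" and \<phi>: "frame_congruence L \<phi>"
  shows "ext (\<theta> \<inter> \<phi>) = ext \<theta> \<sqinter>\<^bsub>N\<^esub> ext \<phi>"
proof (rule M.le_antisym)
  note Int = L.frame_congruence_Int[OF \<theta> \<phi>]
  note [simp] = ext_closed[OF \<theta>] ext_closed[OF \<phi>] ext_closed[OF Int]
  show "ext (\<theta> \<inter> \<phi>) \<in> carrier N" "ext \<theta> \<sqinter>\<^bsub>N\<^esub> ext \<phi> \<in> carrier N" by simp_all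
  show "ext (\<theta> \<inter> \<phi>) \<sqsubseteq>\<^bsub>N\<^esub> ext \<theta> \<sqinter>\<^bsub>N\<^esub> ext \<phi>"
    by (simp add: M.le_meet_iff ext_mono \<theta> \<phi> Int)
  have piece: "(g x \<sqinter>\<^bsub>N\<^esub> cpl y) \<sqinter>\<^bsub>N\<^esub> (g u \<sqinter>\<^bsub>N\<^esub> cpl v) \<sqsubseteq>\<^bsub>N\<^esub> ext (\<theta> \<inter> \<phi>)"
    if xy: "x \<in> carrier L" "y \<in> carrier L" "le_mod L \<theta> x y"
      and uv: "u \<in> carrier L" "v \<in> carrier L" "le_mod L \<phi> u v" for x y u v
  proof -
    note [simp] = xy(1,2) uv(1,2)
    let ?t = "(g x \<sqinter>\<^bsub>N\<^esub> cpl y) \<sqinter>\<^bsub>N\<^esub> (g u \<sqinter>\<^bsub>N\<^esub> cpl v)"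
    let ?a = "x \<sqinter>\<^bsub>L\<^esub> u" and ?b = "y \<squnion>\<^bsub>L\<^esub> v"
    have below: "?t \<sqsubseteq>\<^bsub>N\<^esub> g x" "?t \<sqsubseteq>\<^bsub>N\<^esub> cpl y" "?t \<sqsubseteq>\<^bsub>N\<^esub> g u" "?t \<sqsubseteq>\<^bsub>N\<^esub> cpl v"
      by (rule M.le_trans[OF M.meet_left M.meet_left] M.le_trans[OF M.meet_left M.meet_right]
        M.le_trans[OF M.meet_right M.meet_left] M.le_trans[OF M.meet_right M.meet_right]; simp)+
    have "le_mod L \<theta> ?a y"
      by (rule L.le_mod_trans[OF \<theta> _ xy(3)]) (simp_all add: L.le_mod_le[OF \<theta>] L.meet_left)
    then have 1: "le_mod L \<theta> ?a ?b"
      by (rule L.le_mod_trans[OF \<theta>]) (simp_all add: L.le_mod_le[OF \<theta>] L.join_left)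
    have "le_mod L \<phi> ?a v"
      by (rule L.le_mod_trans[OF \<phi> _ uv(3)]) (simp_all add: L.le_mod_le[OF \<phi>] L.meet_right)
    then have 2: "le_mod L \<phi> ?a ?b"
      by (rule L.le_mod_trans[OF \<phi>]) (simp_all add: L.le_mod_le[OF \<phi>] L.join_right)
    have "g ?a \<sqinter>\<^bsub>N\<^esub> cpl ?b \<sqsubseteq>\<^bsub>N\<^esub> ext (\<theta> \<inter> \<phi>)"
      using 1 2 by (intro piece_le_ext Int) (simp_all add: L.le_mod_Int)
    then have a: "g ?a \<sqsubseteq>\<^bsub>N\<^esub> g ?b \<squnion>\<^bsub>N\<^esub> ext (\<theta> \<inter> \<phi>)"
      by (simp add: M.meet_complement_le_iff[OF cpl])
    have "?t \<sqsubseteq>\<^bsub>N\<^esub> g ?a" using below by (simp add: hom_meet M.le_meet_iff)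
    then have t: "?t \<sqsubseteq>\<^bsub>N\<^esub> g y \<squnion>\<^bsub>N\<^esub> (g v \<squnion>\<^bsub>N\<^esub> ext (\<theta> \<inter> \<phi>))"
      using M.le_trans[OF _ a, of ?t] by (simp add: hom_join M.join_assoc)
    then have "?t \<sqinter>\<^bsub>N\<^esub> cpl y \<sqsubseteq>\<^bsub>N\<^esub> g v \<squnion>\<^bsub>N\<^esub> ext (\<theta> \<inter> \<phi>)"
      by (simp add: M.meet_complement_le_iff[OF cpl])
    then have "?t \<sqsubseteq>\<^bsub>N\<^esub> g v \<squnion>\<^bsub>N\<^esub> ext (\<theta> \<inter> \<phi>)"
      using M.meet_eq_left[OF _ _ below(2)] by simp
    then have "?t \<sqinter>\<^bsub>N\<^esub> cpl v \<sqsubseteq>\<^bsub>N\<^esub> ext (\<theta> \<inter> \<phi>)"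
      by (simp add: M.meet_complement_le_iff[OF cpl])
    then show ?thesis
      using M.meet_eq_left[OF _ _ below(4)] by simp
  qed
  have ext_eq: "ext \<theta> = \<Squnion>\<^bsub>N\<^esub>(pieces \<theta>)" if "frame_congruence L \<theta>" for \<theta>
    using that by (simp add: cong_extend_def)
  have row: "p \<sqinter>\<^bsub>N\<^esub> ext \<phi> \<sqsubseteq>\<^bsub>N\<^esub> ext (\<theta> \<inter> \<phi>)" if p: "p \<in> pieces \<theta>" for p
  proof -
    have pN: "p \<in> carrier N" using pieces_closed p by (rule subsetD)
    have "p \<sqinter>\<^bsub>N\<^esub> ext \<phi> = \<Squnion>\<^bsub>N\<^esub>((\<lambda>q. p \<sqinter>\<^bsub>N\<^esub> q) ` pieces \<phi>)"
      unfolding ext_eq[OF \<phi>] by (rule M.inf_sup_distrib[OF pN pieces_closed])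
    also have "\<dots> \<sqsubseteq>\<^bsub>N\<^esub> ext (\<theta> \<inter> \<phi>)"
    proof (rule M.sup_least)
      show "(\<lambda>q. p \<sqinter>\<^bsub>N\<^esub> q) ` pieces \<phi> \<subseteq> carrier N"
        by (intro image_subsetI M.meet_closed pN) (rule subsetD[OF pieces_closed])
      fix t assume "t \<in> (\<lambda>q. p \<sqinter>\<^bsub>N\<^esub> q) ` pieces \<phi>"
      then show "t \<sqsubseteq>\<^bsub>N\<^esub> ext (\<theta> \<inter> \<phi>)" using p piece by blast
    qed simp
    finally show ?thesis .
  qed
  have "ext \<theta> \<sqinter>\<^bsub>N\<^esub> ext \<phi> = \<Squnion>\<^bsub>N\<^esub>((\<lambda>q. ext \<phi> \<sqinter>\<^bsub>N\<^esub> q) ` pieces \<theta>)"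
    unfolding M.inf_sup_distrib[OF ext_closed[OF \<phi>] pieces_closed, symmetric] ext_eq[OF \<theta>, symmetric]
    by (rule meet_comm)
  also have "\<dots> \<sqsubseteq>\<^bsub>N\<^esub> ext (\<theta> \<inter> \<phi>)"
  proof (rule M.sup_least)
    show "(\<lambda>q. ext \<phi> \<sqinter>\<^bsub>N\<^esub> q) ` pieces \<theta> \<subseteq> carrier N"
      by (intro image_subsetI M.meet_closed ext_closed[OF \<phi>]) (rule subsetD[OF pieces_closed])
    fix t assume "t \<in> (\<lambda>q. ext \<phi> \<sqinter>\<^bsub>N\<^esub> q) ` pieces \<theta>"
    then obtain p where "p \<in> pieces \<theta>" "t = p \<sqinter>\<^bsub>N\<^esub> ext \<phi>" using meet_comm[of N "ext \<phi>"] by blast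
    then show "t \<sqsubseteq>\<^bsub>N\<^esub> ext (\<theta> \<inter> \<phi>)" using row by simp
  qed simp
  finally show "ext \<theta> \<sqinter>\<^bsub>N\<^esub> ext \<phi> \<sqsubseteq>\<^bsub>N\<^esub> ext (\<theta> \<inter> \<phi>)" .
qed

lemma ext_hom: "ext \<in> frame_hom (congruence_frame L) N"
proof (rule frame_homI)
  show "ext \<theta> \<in> carrier N" if "\<theta> \<in> carrier (congruence_frame L)" for \<theta>
    using that by (simp add: ext_closed)
  show "ext \<in> extensional (carrier (congruence_frame L))" by (simp add: cong_extend_def)
  have "\<top>\<^bsub>congruence_frame L\<^esub> = nabla L \<top>\<^bsub>L\<^esub>"
    using L.unit_hom by (simp add: frame_hom_def unit_def)
  then show "ext \<top>\<^bsub>congruence_frame L\<^esub> = \<top>\<^bsub>N\<^esub>" by (simp add: ext_nabla)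
  show "ext (\<theta> \<sqinter>\<^bsub>congruence_frame L\<^esub> \<phi>) = ext \<theta> \<sqinter>\<^bsub>N\<^esub> ext \<phi>"
    if "\<theta> \<in> carrier (congruence_frame L)" "\<phi> \<in> carrier (congruence_frame L)" for \<theta> \<phi>
    using that by (simp add: L.meet_congruence_frame ext_meet)
qed (rule ext_sup)

text \<open>
  Compactness of complemented elements reduces \<open>ext \<theta> \<sqsubseteq> ext \<phi>\<close> to finitely many of the pieces of
  \<open>ext \<phi>\<close>; those are removed one at a time by distributivity, each removal being mirrored by a
  cut modulo \<open>\<phi>\<close>. At the end a plain inequality between values of \<open>g\<close> remains, which \<open>g\<close> reflects.
\<close>

lemma ext_reflects_order:
  assumes top: "compact_element N \<top>\<^bsub>N\<^esub>"
    and reflects: "\<And>x y. \<lbrakk>x \<in> carrier L; y \<in> carrier L; g x \<sqsubseteq>\<^bsub>N\<^esub> g y\<rbrakk> \<Longrightarrow> x \<sqsubseteq>\<^bsub>L\<^esub> y"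
    and \<theta>: "frame_congruence L \<theta>" and \<phi>: "frame_congruence L \<phi>"
    and le: "ext \<theta> \<sqsubseteq>\<^bsub>N\<^esub> ext \<phi>"
  shows "\<theta> \<subseteq> \<phi>"
  unfolding L.congruence_subset_iff[OF \<theta> \<phi>]
proof (intro ballI impI)
  fix x y assume x[simp]: "x \<in> carrier L" and y[simp]: "y \<in> carrier L" and xy: "le_mod L \<theta> x y"
  \<comment> \<open>\<open>x\<close> and \<open>y\<close> vary, since removing the piece for \<open>(b, a)\<close> changes them to \<open>x \<sqinter> a\<close>, \<open>y\<close> and to
    \<open>x\<close>, \<open>y \<squnion> b\<close>\<close>
  have finite_case: "le_mod L \<phi> x y"
    if "finite F" "F \<subseteq> pieces \<phi>" "x \<in> carrier L" "y \<in> carrier L"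
      "g x \<sqsubseteq>\<^bsub>N\<^esub> g y \<squnion>\<^bsub>N\<^esub> \<Squnion>\<^bsub>N\<^esub>F" for F x y
    using that
  proof (induction F arbitrary: x y rule: finite_induct)
    case empty
    then have "g x \<sqsubseteq>\<^bsub>N\<^esub> g y"
      by (simp add: M.sup_empty_eq join_comm[of N "g y"] M.bottom_join_eq)
    then show ?case using empty by (intro L.le_mod_le[OF \<phi>] reflects)
  next
    case (insert p F)
    note [simp] = insert.prems(2,3)
    obtain b a where p: "p = g b \<sqinter>\<^bsub>N\<^esub> cpl a" and ba[simp]: "b \<in> carrier L" "a \<in> carrier L"
      and le_ba: "le_mod L \<phi> b a"
      using insert.prems(1) by blast
    have F: "F \<subseteq> pieces \<phi>" using insert.prems(1) by simp
    then have FN: "F \<subseteq> carrier N" using pieces_closed by (rule subset_trans)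
    have s[simp]: "\<Squnion>\<^bsub>N\<^esub>F \<in> carrier N" using FN by simp
    have pN[simp]: "p \<in> carrier N" by (simp add: p)
    let ?r = "g y \<squnion>\<^bsub>N\<^esub> \<Squnion>\<^bsub>N\<^esub>F"
    have le: "g x \<sqsubseteq>\<^bsub>N\<^esub> p \<squnion>\<^bsub>N\<^esub> ?r"
    proof -
      have "g y \<squnion>\<^bsub>N\<^esub> \<Squnion>\<^bsub>N\<^esub>(insert p F) = g y \<squnion>\<^bsub>N\<^esub> (p \<squnion>\<^bsub>N\<^esub> \<Squnion>\<^bsub>N\<^esub>F)"
        by (simp only: M.sup_insert_eq[OF pN FN])
      also have "\<dots> = p \<squnion>\<^bsub>N\<^esub> ?r"
        using M.join_assoc[of "g y" p "\<Squnion>\<^bsub>N\<^esub>F"] M.join_assoc[of p "g y" "\<Squnion>\<^bsub>N\<^esub>F"]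
        by (simp add: join_comm[of N "g y" p])
      finally show ?thesis using insert.prems(4) by simp
    qed
    have low: "le_mod L \<phi> (x \<sqinter>\<^bsub>L\<^esub> a) y"
    proof (rule insert.IH[OF F])
      have "g a \<sqinter>\<^bsub>N\<^esub> p \<sqsubseteq>\<^bsub>N\<^esub> \<bottom>\<^bsub>N\<^esub>"
      proof -
        have "p \<sqsubseteq>\<^bsub>N\<^esub> cpl a" by (simp add: p M.meet_right)
        then have "g a \<sqinter>\<^bsub>N\<^esub> p \<sqsubseteq>\<^bsub>N\<^esub> g a \<sqinter>\<^bsub>N\<^esub> cpl a"
          using M.le_trans[OF M.meet_right, of "g a" p "cpl a"] by (simp add: M.le_meet_iff M.meet_left)
        then show ?thesis using cpl[of a] by (simp add: complement_in_def)
      qed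
      then have ap: "g a \<sqinter>\<^bsub>N\<^esub> p \<sqsubseteq>\<^bsub>N\<^esub> ?r" by (rule M.le_trans) simp_all
      have "g (x \<sqinter>\<^bsub>L\<^esub> a) \<sqsubseteq>\<^bsub>N\<^esub> g a \<sqinter>\<^bsub>N\<^esub> (p \<squnion>\<^bsub>N\<^esub> ?r)"
        using M.le_trans[OF M.meet_left le, of "g a"]
        by (simp add: hom_meet M.le_meet_iff M.meet_right)
      also have "g a \<sqinter>\<^bsub>N\<^esub> (p \<squnion>\<^bsub>N\<^esub> ?r) = (g a \<sqinter>\<^bsub>N\<^esub> p) \<squnion>\<^bsub>N\<^esub> (g a \<sqinter>\<^bsub>N\<^esub> ?r)"
        by (simp add: M.meet_join_distrib[of "g a" p ?r])
      also have "\<dots> \<sqsubseteq>\<^bsub>N\<^esub> ?r" using ap by (simp add: M.join_le_iff M.meet_right)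
      finally show "g (x \<sqinter>\<^bsub>L\<^esub> a) \<sqsubseteq>\<^bsub>N\<^esub> ?r" by simp
    qed simp_all
    have high: "le_mod L \<phi> x (y \<squnion>\<^bsub>L\<^esub> a)"
    proof -
      have "le_mod L \<phi> x (y \<squnion>\<^bsub>L\<^esub> b)"
      proof (rule insert.IH[OF F])
        have "p \<squnion>\<^bsub>N\<^esub> ?r \<sqsubseteq>\<^bsub>N\<^esub> g b \<squnion>\<^bsub>N\<^esub> ?r"
        proof -
          have "p \<sqsubseteq>\<^bsub>N\<^esub> g b \<squnion>\<^bsub>N\<^esub> ?r"
            unfolding p by (rule M.le_trans[OF M.meet_left M.join_left]) simp_all
          then show ?thesis by (simp add: M.join_le_iff M.join_right)
        qed
        also have "g b \<squnion>\<^bsub>N\<^esub> ?r = g (y \<squnion>\<^bsub>L\<^esub> b) \<squnion>\<^bsub>N\<^esub> \<Squnion>\<^bsub>N\<^esub>F"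
          by (simp add: hom_join M.join_assoc[symmetric] join_comm[of N "g b" "g y"])
        finally have "p \<squnion>\<^bsub>N\<^esub> ?r \<sqsubseteq>\<^bsub>N\<^esub> g (y \<squnion>\<^bsub>L\<^esub> b) \<squnion>\<^bsub>N\<^esub> \<Squnion>\<^bsub>N\<^esub>F" by simp
        then show "g x \<sqsubseteq>\<^bsub>N\<^esub> g (y \<squnion>\<^bsub>L\<^esub> b) \<squnion>\<^bsub>N\<^esub> \<Squnion>\<^bsub>N\<^esub>F"
          by (rule M.le_trans[OF le]) simp_all
      qed simp_all
      moreover have "le_mod L \<phi> (y \<squnion>\<^bsub>L\<^esub> b) (y \<squnion>\<^bsub>L\<^esub> a)"
      proof (rule L.le_mod_join[OF \<phi>])
        show "le_mod L \<phi> b (y \<squnion>\<^bsub>L\<^esub> a)"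
          by (rule L.le_mod_trans[OF \<phi> le_ba]) (simp_all add: L.le_mod_le[OF \<phi>] L.join_right)
      qed (simp_all add: L.le_mod_le[OF \<phi>] L.join_left)
      ultimately show ?thesis by (rule L.le_mod_trans[OF \<phi>]) simp_all
    qed
    show ?case by (rule L.le_mod_cut[OF \<phi> high low]) simp_all
  qed
  have "compact_element N (g x)"
    by (rule M.compact_complemented[OF top hom_closed[OF x] cpl[OF x]])
  moreover have "g x \<sqsubseteq>\<^bsub>N\<^esub> g y \<squnion>\<^bsub>N\<^esub> ext \<phi>"
  proof -
    have "g x \<sqinter>\<^bsub>N\<^esub> cpl y \<sqsubseteq>\<^bsub>N\<^esub> ext \<phi>"
      by (rule M.le_trans[OF piece_le_ext[OF \<theta> x y xy] le]) (simp_all add: ext_closed \<theta> \<phi>)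
    then show ?thesis by (simp add: M.meet_complement_le_iff[OF cpl] ext_closed \<phi>)
  qed
  then have "g x \<sqsubseteq>\<^bsub>N\<^esub> g y \<squnion>\<^bsub>N\<^esub> \<Squnion>\<^bsub>N\<^esub>(pieces \<phi>)"
    using \<phi> by (simp add: cong_extend_def)
  ultimately obtain F where F: "F \<subseteq> pieces \<phi>" "finite F" "g x \<sqsubseteq>\<^bsub>N\<^esub> g y \<squnion>\<^bsub>N\<^esub> \<Squnion>\<^bsub>N\<^esub>F"
    using M.compact_le_join_sup[OF _ hom_closed[OF y] pieces_closed] by meson
  show "le_mod L \<phi> x y" by (rule finite_case[OF F(2,1) x y F(3)])
qed

end

section \<open>Strictly zero-dimensional biframes\<close>

locale str0d =
  fixes M :: "'a biframe"
  assumes str0d: "M \<in> Str0DBiFrm"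
begin

abbreviation "T \<equiv> total M"
abbreviation "complements \<equiv> {c. \<exists>a\<in>first M. complement_in T a c}"

lemma frame_total: "frame T"
  and subframe_first: "subframe T (first M)"
  and subframe_second: "subframe T (second M)"
  and generates: "generated_subframe T (first M \<union> second M) = carrier T"
  and first_complement: "a \<in> first M \<Longrightarrow> \<exists>c\<in>second M. complement_in T a c"
  and second_eq: "second M = generated_subframe T complements"
  using str0d unfolding Str0DBiFrm_def is_biframe_def by blast+

interpretation T: frm T
  by (simp add: frm_def frame_total)

lemma first_closed: "a \<in> first M \<Longrightarrow> a \<in> carrier T"
  using subframe_first by (auto simp: subframe_def)

lemma second_closed: "a \<in> second M \<Longrightarrow> a \<in> carrier T"
  using subframe_second by (auto simp: subframe_def)

lemma complement_in_second: "\<lbrakk>a \<in> first M; complement_in T a c\<rbrakk> \<Longrightarrow> c \<in> second M"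
  using first_complement T.complement_unique first_closed by blast

lemma complements_closed: "complements \<subseteq> carrier T"
  by (auto simp: complement_in_def)

lemma subframe_eq_carrier:
  assumes S: "subframe T S" and first: "first M \<subseteq> S" and compl: "complements \<subseteq> S"
  shows "S = carrier T"
proof
  show "S \<subseteq> carrier T" using S by (simp add: subframe_def)
  have "second M \<subseteq> S"
    unfolding second_eq by (rule T.generated_subframe_least[OF S compl])
  with first show "carrier T \<subseteq> S"
    unfolding generates[symmetric] by (intro T.generated_subframe_least[OF S]) simp
qed

text \<open>
  Complements are unique and preserved by homomorphisms, so the values on the first part determine
  those on the second.
\<close>

lemma hom_eqI:
  assumes N: "frame N" and f: "f \<in> frame_hom T N" and g: "g \<in> frame_hom T N"
    and eq: "\<And>a. a \<in> first M \<Longrightarrow> f a = g a"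
  shows "f = g"
proof (rule frame_hom_ext[OF f g])
  interpret f: frm_hom T N f by (simp add: frame_total N f frm_homI)
  interpret g: frm_hom T N g by (simp add: frame_total N g frm_homI)
  have compl: "f c = g c" if "a \<in> first M" "complement_in T a c" for a c
  proof (rule f.M.complement_unique)
    show "complement_in N (f a) (f c)"
      by (rule f.hom_complement[OF first_closed[OF that(1)] that(2)])
    show "complement_in N (f a) (g c)"
      unfolding eq[OF that(1)] by (rule g.hom_complement[OF first_closed[OF that(1)] that(2)])
    show "f a \<in> carrier N" by (simp add: first_closed that)
  qed
  have second: "f x = g x" if "x \<in> second M" for x
  proof (rule frame_hom_eq_on_generated[OF frame_total N f g])
    show "x \<in> generated_subframe T complements" using that by (simp add: second_eq)
    show "y \<in> carrier T \<and> f y = g y" if "y \<in> complements" for y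
      using that compl complements_closed by blast
  qed
  fix x assume "x \<in> carrier T"
  show "f x = g x"
  proof (rule frame_hom_eq_on_generated[OF frame_total N f g])
    show "x \<in> generated_subframe T (first M \<union> second M)"
      using \<open>x \<in> carrier T\<close> by (simp add: generates)
    show "y \<in> carrier T \<and> f y = g y" if "y \<in> first M \<union> second M" for y
      using that eq second first_closed second_closed by blast
  qed
qed

lemma frm_sub_first: "frm_sub T (first M)"
  by unfold_locales (rule subframe_first)

lemma frame_first_part: "frame (first_part M)"
  unfolding first_part_def by (rule frm_sub.frame_sub[OF frm_sub_first])

lemma carrier_first_part [simp]: "carrier (first_part M) = first M"
  by (simp add: first_part_def)

lemma first_inclusion_hom: "(\<lambda>x\<in>first M. x) \<in> frame_hom (first_part M) T"
  unfolding first_part_def by (rule frm_sub.inclusion_hom[OF frm_sub_first])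

lemma le_first_part: "a \<sqsubseteq>\<^bsub>first_part M\<^esub> b \<longleftrightarrow> a \<sqsubseteq>\<^bsub>T\<^esub> b"
  by (simp add: first_part_def)

end

text \<open>Preservation of the second part is automatic, as it is generated by complements.\<close>

lemma biframe_homI:
  assumes M: "M \<in> Str0DBiFrm" and N: "N \<in> Str0DBiFrm"
    and f: "f \<in> frame_hom (total M) (total N)" and first: "f ` first M \<subseteq> first N"
  shows "f \<in> biframe_hom M N"
proof -
  interpret M: str0d M by unfold_locales (rule M)
  interpret N: str0d N by unfold_locales (rule N)
  interpret f: frm_hom "total M" "total N" f
    by (simp add: M.frame_total N.frame_total f frm_homI)
  let ?V = "{x \<in> carrier (total M). f x \<in> second N}"
  have "M.complements \<subseteq> ?V"
  proof
    fix c assume "c \<in> M.complements"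
    then obtain a where a: "a \<in> first M" "complement_in (total M) a c" by blast
    have "complement_in (total N) (f a) (f c)"
      by (rule f.hom_complement[OF M.first_closed[OF a(1)] a(2)])
    then have "f c \<in> second N"
      using N.complement_in_second first a(1) by blast
    then show "c \<in> ?V" using a(2) by (simp add: complement_in_def)
  qed
  then have "second M \<subseteq> ?V"
    unfolding M.second_eq
    by (rule f.L.generated_subframe_least[OF f.subframe_vimage[OF N.subframe_second]])
  then show ?thesis
    unfolding biframe_hom_def using f first by blast
qed

lemma (in frm_hom) corestrict_hom:
  assumes S: "subframe M S" and im: "f ` carrier L \<subseteq> S"
  shows "f \<in> frame_hom L (M\<lparr>carrier := S\<rparr>)"
proof -
  interpret S: frm_sub M S by unfold_locales (rule S)
  have fS: "f x \<in> S" if "x \<in> carrier L" for x using im that by blast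
  show ?thesis
  proof (rule frame_homI)
    show "f \<in> extensional (carrier L)" using hom by (auto simp: frame_hom_def PiE_iff)
    fix U assume U: "U \<subseteq> carrier L"
    then have "f ` U \<subseteq> S" using im by blast
    then show "f (\<Squnion>\<^bsub>L\<^esub>U) = \<Squnion>\<^bsub>M\<lparr>carrier := S\<rparr>\<^esub>(f ` U)"
      by (simp add: S.sup_sub hom_sup U)
  qed (simp_all add: fS S.top_sub S.meet_sub hom_meet)
qed

lemma first_part_map_hom:
  assumes M: "M \<in> Str0DBiFrm" and N: "N \<in> Str0DBiFrm" and f: "f \<in> biframe_hom M N"
  shows "first_part_map M f \<in> frame_hom (first_part M) (first_part N)"
proof -
  interpret M: str0d M by unfold_locales (rule M)
  interpret N: str0d N by unfold_locales (rule N)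
  have f': "f \<in> frame_hom (total M) (total N)" "f ` first M \<subseteq> first N"
    using f by (auto simp: biframe_hom_def)
  have eq: "first_part_map M f = compose (carrier (first_part M)) f (\<lambda>x\<in>first M. x)"
    by (auto simp: first_part_map_def compose_def)
  have "first_part_map M f \<in> frame_hom (first_part M) (total N)"
    unfolding eq
    by (rule frame_hom_compose[OF M.frame_first_part M.frame_total N.frame_total M.first_inclusion_hom f'(1)])
  then interpret h: frm_hom "first_part M" "total N" "first_part_map M f"
    by (simp add: M.frame_first_part N.frame_total frm_homI)
  show ?thesis
    unfolding first_part_def[of N]
    by (rule h.corestrict_hom[OF N.subframe_first]) (use f'(2) in \<open>auto simp: first_part_map_def\<close>)
qed

section \<open>The congruence biframe\<close>

lemma total_cong_biframe [simp]: "total (cong_biframe L) = congruence_frame L"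
  and first_cong_biframe [simp]: "first (cong_biframe L) = nabla L ` carrier L"
  and second_cong_biframe: "second (cong_biframe L) =
    generated_subframe (congruence_frame L) (delta L ` carrier L)"
  by (simp_all add: cong_biframe_def)

context frm
begin

interpretation C: frm CL by (rule frm_congruence_frame)

lemma unit_frm_hom: "frm_hom L CL (unit L)"
  by unfold_locales (rule unit_hom)

lemma unit_image: "unit L ` carrier L = nabla L ` carrier L"
  by (rule image_cong) (simp_all add: unit_def)

lemma subframe_nabla: "subframe CL (nabla L ` carrier L)"
  using frm_hom.subframe_image[OF unit_frm_hom subframe_carrier] by (simp only: unit_image)

lemma cong_biframe_str0d: "cong_biframe L \<in> Str0DBiFrm"
proof -
  let ?K = "{c. \<exists>a\<in>nabla L ` carrier L. complement_in CL a c}"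
  let ?D = "generated_subframe CL (delta L ` carrier L)"
  have DC: "delta L ` carrier L \<subseteq> carrier CL"
    by (rule image_subsetI) (simp add: frame_congruence_delta)
  have K: "?K = delta L ` carrier L"
  proof (intro subset_antisym subsetI)
    fix c assume "c \<in> ?K"
    then obtain a where a: "a \<in> carrier L" "complement_in CL (nabla L a) c" by blast
    have "c = delta L a"
      by (rule C.complement_unique[OF a(2) nabla_delta_complement[OF a(1)]])
        (simp add: frame_congruence_nabla a)
    then show "c \<in> delta L ` carrier L" using a(1) by blast
  next
    fix c assume "c \<in> delta L ` carrier L"
    then show "c \<in> ?K" using nabla_delta_complement by blast
  qed
  have sub: "subframe CL ?D" by (rule C.subframe_generated[OF DC])
  have DL: "delta L a \<in> ?D" if "a \<in> carrier L" for a
    using C.generated_subframe_superset that by blast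
  have NC: "nabla L ` carrier L \<subseteq> carrier CL" and D: "?D \<subseteq> carrier CL"
    using subframe_nabla sub by (simp_all add: subframe_def)
  have "carrier CL \<subseteq> generated_subframe CL (nabla L ` carrier L \<union> ?D)"
    (is "_ \<subseteq> ?G")
  proof
    fix \<theta> assume "\<theta> \<in> carrier CL"
    then have \<theta>: "frame_congruence L \<theta>" by simp
    have G: "subframe CL ?G" by (rule C.subframe_generated) (use NC D in blast)
    have sub: "nabla L ` carrier L \<union> ?D \<subseteq> ?G" by (rule C.generated_subframe_superset)
    have "nabla L x \<sqinter>\<^bsub>CL\<^esub> delta L y \<in> ?G" if "x \<in> carrier L" "y \<in> carrier L" for x y
    proof -
      have "nabla L x \<in> ?G" "delta L y \<in> ?G" using sub that DL by blast+
      then show ?thesis using G by (simp add: subframe_def)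
    qed
    then have "{nabla L x \<sqinter>\<^bsub>CL\<^esub> delta L y | x y. x \<in> carrier L \<and> y \<in> carrier L \<and> le_mod L \<theta> x y} \<subseteq> ?G"
      by blast
    then have "\<Squnion>\<^bsub>CL\<^esub>{nabla L x \<sqinter>\<^bsub>CL\<^esub> delta L y | x y.
        x \<in> carrier L \<and> y \<in> carrier L \<and> le_mod L \<theta> x y} \<in> ?G"
      using G unfolding subframe_def by blast
    then show "\<theta> \<in> ?G" by (simp only: congruence_eq_sup(2)[OF \<theta>, symmetric])
  qed
  moreover have "generated_subframe CL (nabla L ` carrier L \<union> ?D) \<subseteq> carrier CL"
    by (rule C.generated_subframe_closed) (use NC D in blast)
  ultimately have "generated_subframe CL (nabla L ` carrier L \<union> ?D) = carrier CL"
    by (rule subset_antisym[rotated])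
  then have "is_biframe (cong_biframe L)"
    using frame_congruence_frame subframe_nabla sub
    by (simp add: is_biframe_def second_cong_biframe)
  moreover have "\<exists>c\<in>?D. complement_in CL a c" if "a \<in> nabla L ` carrier L" for a
    using that DL nabla_delta_complement by blast
  ultimately show ?thesis
    by (simp add: Str0DBiFrm_def second_cong_biframe K del: bex_simps ball_simps)
qed

end

text \<open>
  Uniqueness holds because the closed congruences are the first part of a strictly
  zero-dimensional biframe.
\<close>

lemma (in complemented_hom) the_ext:
  "(THE h. h \<in> frame_hom (congruence_frame L) N \<and> (\<forall>a\<in>carrier L. h (nabla L a) = g a)) = ext"
proof (rule the_equality)
  show "ext \<in> frame_hom (congruence_frame L) N \<and> (\<forall>a\<in>carrier L. ext (nabla L a) = g a)"
    by (simp add: ext_hom ext_nabla)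
  interpret C: str0d "cong_biframe L" by unfold_locales (rule L.cong_biframe_str0d)
  fix h assume h: "h \<in> frame_hom (congruence_frame L) N \<and> (\<forall>a\<in>carrier L. h (nabla L a) = g a)"
  show "h = ext"
    by (rule C.hom_eqI[of N]) (use h ext_hom ext_nabla M.frame_axioms in auto)
qed

lemma cong_map_complemented_hom:
  assumes L: "frame L" and M: "frame M" and f: "f \<in> frame_hom L M"
  shows "complemented_hom L (congruence_frame M) (compose (carrier L) (unit M) f)"
proof -
  interpret L: frm L by (simp add: frm_def L)
  interpret M: frm M by (simp add: frm_def M)
  interpret f: frm_hom L M f by unfold_locales (rule f)
  interpret CM: frm "congruence_frame M" by (rule M.frm_congruence_frame)
  show ?thesis
  proof unfold_locales
    show "compose (carrier L) (unit M) f \<in> frame_hom L (congruence_frame M)"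
      by (rule frame_hom_compose[OF L M M.frame_congruence_frame f M.unit_hom])
    show "\<exists>c. complement_in (congruence_frame M) (compose (carrier L) (unit M) f a) c"
      if "a \<in> carrier L" for a
      using M.nabla_delta_complement[of "f a"] that by (auto simp: compose_eq unit_def)
  qed
qed

lemma
  assumes L: "frame L" and M: "frame M" and f: "f \<in> frame_hom L M"
  shows cong_map_hom: "cong_map L M f \<in> frame_hom (congruence_frame L) (congruence_frame M)"
    and cong_map_nabla: "a \<in> carrier L \<Longrightarrow> cong_map L M f (nabla L a) = nabla M (f a)"
proof -
  interpret h: complemented_hom L "congruence_frame M" "compose (carrier L) (unit M) f"
    by (rule cong_map_complemented_hom[OF assms])
  interpret f: frm_hom L M f by (simp add: L M f frm_homI)
  have g: "compose (carrier L) (unit M) f a = nabla M (f a)" if "a \<in> carrier L" for a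
    using that by (simp add: compose_eq unit_def)
  have "cong_map L M f = h.ext"
    unfolding h.the_ext[symmetric] cong_map_def by (simp add: g cong: ball_cong)
  then show "cong_map L M f \<in> frame_hom (congruence_frame L) (congruence_frame M)"
    "a \<in> carrier L \<Longrightarrow> cong_map L M f (nabla L a) = nabla M (f a)"
    by (simp_all add: h.ext_hom h.ext_nabla g)
qed

lemma cong_map_eqI:
  assumes L: "frame L" and M: "frame M" and f: "f \<in> frame_hom L M"
    and h: "h \<in> frame_hom (congruence_frame L) (congruence_frame M)"
    and nabla: "\<And>a. a \<in> carrier L \<Longrightarrow> h (nabla L a) = nabla M (f a)"
  shows "cong_map L M f = h"
proof -
  interpret C: str0d "cong_biframe L"
    by unfold_locales (rule frm.cong_biframe_str0d, simp add: frm_def L)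
  have M': "frm M" by (simp add: frm_def M)
  show ?thesis
    by (rule C.hom_eqI[of "congruence_frame M"])
      (use h cong_map_hom[OF L M f] cong_map_nabla[OF L M f] nabla
        frm.frame_congruence_frame[OF M'] in auto)
qed

lemma (in str0d) counit_complemented_hom:
  "complemented_hom (first_part M) T (\<lambda>x\<in>first M. x)"
proof -
  interpret T: frm T by (simp add: frm_def frame_total)
  interpret F: frm "first_part M" by (simp add: frm_def frame_first_part)
  show ?thesis
    by unfold_locales (use first_inclusion_hom first_complement in auto)
qed

lemma (in str0d)
  shows counit_eq: "counit M = cong_extend (first_part M) T (\<lambda>x\<in>first M. x)"
    and counit_hom: "counit M \<in> frame_hom (congruence_frame (first_part M)) T"
    and counit_nabla: "a \<in> first M \<Longrightarrow> counit M (nabla (first_part M) a) = a"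
proof -
  interpret h: complemented_hom "first_part M" T "\<lambda>x\<in>first M. x"
    by (rule counit_complemented_hom)
  show eq: "counit M = h.ext"
    unfolding h.the_ext[symmetric] counit_def by (simp cong: ball_cong)
  show "counit M \<in> frame_hom (congruence_frame (first_part M)) T"
    "a \<in> first M \<Longrightarrow> counit M (nabla (first_part M) a) = a"
    unfolding eq using h.ext_nabla[of a] by (simp_all add: h.ext_hom)
qed

section \<open>Compactness\<close>

text \<open>
  In a Noetherian frame every join is a finite join, so a directed union of congruences is again
  closed under arbitrary joins. Hence the join of \<open>S\<close> is the union of its finite subjoins, and if
  it identifies bottom and top, then so does one of them.
\<close>

lemma (in frm) compact_congruence_frame:
  assumes noeth: "\<And>a. a \<in> carrier L \<Longrightarrow> compact_element L a"
  shows "compact_frame CL"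
proof -
  interpret C: frm CL by (rule frm_congruence_frame)
  have "\<exists>F\<subseteq>S. finite F \<and> \<top>\<^bsub>CL\<^esub> \<subseteq> \<Squnion>\<^bsub>CL\<^esub>F"
    if S: "S \<subseteq> carrier CL" and top: "\<top>\<^bsub>CL\<^esub> \<subseteq> \<Squnion>\<^bsub>CL\<^esub>S" for S
  proof -
    let ?Q = "\<lambda>F x y. F \<subseteq> S \<and> finite F \<and> le_mod L (\<Squnion>\<^bsub>CL\<^esub>F) x y"
    \<comment> \<open>the union of the finite subjoins, as a preorder\<close>
    let ?P = "\<lambda>x y. \<exists>F. ?Q F x y"
    have J: "frame_congruence L (\<Squnion>\<^bsub>CL\<^esub>F)" if "F \<subseteq> S" for F
      using C.sup_closed[OF subset_trans[OF that S]] by simp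
    have mono: "le_mod L (\<Squnion>\<^bsub>CL\<^esub>G) x y" if "le_mod L (\<Squnion>\<^bsub>CL\<^esub>F) x y" "F \<subseteq> G" "G \<subseteq> S" for F G x y
      using that(1) C.sup_mono[OF that(2) subset_trans[OF that(3) S]] by (auto simp: le_mod_def)
    have P: "frame_preorder L ?P"
    proof (rule frame_preorderI)
      fix x y assume xy: "x \<in> carrier L" "y \<in> carrier L"
      show "?P x y" if "x \<sqsubseteq> y"
        using le_mod_le[OF J xy that, of "{}"] by (intro exI[of _ "{}"]) simp
      fix z assume z: "z \<in> carrier L"
      show "?P x z" if Pxy: "?P x y" and Pyz: "?P y z"
      proof -
        obtain F G where F: "?Q F x y" and G: "?Q G y z" using Pxy Pyz by blast
        have FG: "F \<union> G \<subseteq> S" using F G by blast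
        have "le_mod L (\<Squnion>\<^bsub>CL\<^esub>(F \<union> G)) x z"
          by (rule le_mod_trans[OF J[OF FG] mono[of F _ _ "F \<union> G"] mono[of G _ _ "F \<union> G"]])
            (use F G FG xy z in blast)+
        then show ?thesis using F G by (intro exI[of _ "F \<union> G"]) simp
      qed
      show "?P z (x \<sqinter> y)" if Pzx: "?P z x" and Pzy: "?P z y"
      proof -
        obtain F G where F: "?Q F z x" and G: "?Q G z y" using Pzx Pzy by blast
        have FG: "F \<union> G \<subseteq> S" using F G by blast
        have "le_mod L (\<Squnion>\<^bsub>CL\<^esub>(F \<union> G)) z (x \<sqinter> y)"
          by (rule le_mod_meet[OF J[OF FG] mono[of F _ _ "F \<union> G"] mono[of G _ _ "F \<union> G"]])
            (use F G FG xy z in blast)+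
        then show ?thesis using F G by (intro exI[of _ "F \<union> G"]) simp
      qed
    next
      fix T z assume T: "T \<subseteq> carrier L" and z: "z \<in> carrier L" and Pt: "\<And>t. t \<in> T \<Longrightarrow> ?P t z"
      have "compact_element L (\<Squnion>T)" by (rule noeth[OF sup_closed[OF T]])
      then obtain T0 where T0: "T0 \<subseteq> T" "finite T0" "\<Squnion>T \<sqsubseteq> \<Squnion>T0"
        using T le_refl[OF sup_closed[OF T]] unfolding compact_element_def by blast
      have T0L: "T0 \<subseteq> carrier L" using T0(1) T by (rule subset_trans)
      have "\<exists>F. \<forall>t\<in>T0. ?Q (F t) t z"
        using Pt T0(1) by (intro bchoice ballI) blast
      then obtain F where F: "\<And>t. t \<in> T0 \<Longrightarrow> ?Q (F t) t z" by blast
      let ?U = "\<Union>t\<in>T0. F t"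
      have U: "?U \<subseteq> S" "finite ?U" using F T0(2) by blast+
      have "le_mod L (\<Squnion>\<^bsub>CL\<^esub>?U) (\<Squnion>T0) z"
      proof (rule le_mod_sup[OF J[OF U(1)] _ T0L z])
        fix t assume t: "t \<in> T0"
        show "le_mod L (\<Squnion>\<^bsub>CL\<^esub>?U) t z"
          by (rule mono[of "F t"]) (use F[OF t] t U(1) in blast)+
      qed
      then have "le_mod L (\<Squnion>\<^bsub>CL\<^esub>?U) (\<Squnion>T) z"
        by (rule le_mod_trans[OF J[OF U(1)] le_mod_le[OF J[OF U(1)]], rotated 3])
          (simp_all add: T0 T0L T z)
      then show "?P (\<Squnion>T) z" using U by blast
    qed
    let ?U = "preorder_cong L ?P"
    have U: "frame_congruence L ?U" by (rule frame_congruence_preorder_cong[OF P])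
    have "s \<subseteq> ?U" if s: "s \<in> S" for s
    proof -
      have sc: "frame_congruence L s" using subsetD[OF S s] by simp
      have "?P x y" if "le_mod L s x y" for x y
        using that s C.sup_of_singleton[OF subsetD[OF S s]] by (intro exI[of _ "{s}"]) simp
      then show ?thesis
        unfolding congruence_subset_iff[OF sc U] by (simp add: le_mod_preorder_cong[OF P])
    qed
    then have sub: "\<Squnion>\<^bsub>CL\<^esub>S \<subseteq> ?U" using sup_subset_iff[OF S U] by blast
    have "(\<bottom>, \<top>) \<in> \<Squnion>\<^bsub>CL\<^esub>S" using top by (auto simp: top_congruence_frame)
    with sub have "(\<bottom>, \<top>) \<in> ?U" by (rule subsetD)
    then obtain F where F: "F \<subseteq> S" "finite F" "le_mod L (\<Squnion>\<^bsub>CL\<^esub>F) \<top> \<bottom>"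
      by (auto simp: preorder_cong_def)
    then have "\<Squnion>\<^bsub>CL\<^esub>F = \<top>\<^bsub>CL\<^esub>"
      by (simp only: top_congruence_frame top_subset_iff[OF J[OF F(1)]])
    then show ?thesis using F by blast
  qed
  then show ?thesis
    by (simp add: compact_frame_def compact_element_def frame_congruence_frame del: carrier_congruence_frame)
qed

text \<open>
  Every element of the first part is complemented in the compact total part, hence compact there;
  joins in the first part are joins in the total part.
\<close>

lemma (in str0d) noetherian_first_part:
  assumes top: "compact_element T \<top>\<^bsub>T\<^esub>"
  shows "first_part M \<in> NoethFrm"
proof -
  interpret F: frm_sub T "first M" by (rule frm_sub_first)
  have "compact_element (first_part M) a" if a: "a \<in> first M" for a
  proof -
    obtain c where c: "complement_in T a c" using first_complement[OF a] by blast
    have comp: "compact_element T a"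
      by (rule F.compact_complemented[OF top first_closed[OF a] c])
    show ?thesis
      unfolding compact_element_def
    proof (intro conjI allI impI)
      show "a \<in> carrier (first_part M)" using a by simp
      fix S assume "S \<subseteq> carrier (first_part M)" and le: "a \<sqsubseteq>\<^bsub>first_part M\<^esub> \<Squnion>\<^bsub>first_part M\<^esub>S"
      then have S: "S \<subseteq> first M" by simp
      then have ST: "S \<subseteq> carrier T" using first_closed by blast
      have sup: "\<Squnion>\<^bsub>first_part M\<^esub>F = \<Squnion>\<^bsub>T\<^esub>F" if "F \<subseteq> S" for F
        unfolding first_part_def by (rule F.sup_sub[OF subset_trans[OF that S]])
      have "a \<sqsubseteq>\<^bsub>T\<^esub> \<Squnion>\<^bsub>T\<^esub>S" using le by (simp add: le_first_part sup)
      then obtain F where "F \<subseteq> S" "finite F" "a \<sqsubseteq>\<^bsub>T\<^esub> \<Squnion>\<^bsub>T\<^esub>F"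
        using comp ST unfolding compact_element_def by blast
      then show "\<exists>F\<subseteq>S. finite F \<and> a \<sqsubseteq>\<^bsub>first_part M\<^esub> \<Squnion>\<^bsub>first_part M\<^esub>F"
        by (intro exI[of _ F]) (simp add: le_first_part sup)
    qed
  qed
  then show ?thesis by (simp add: NoethFrm_def Frm_def frame_first_part)
qed

text \<open>
  The image of the counit is a subframe that contains the first part and all complements of its
  elements, so it is everything. Injectivity is \<open>ext_reflects_order\<close>, as the inclusion of the first part
  reflects the order.
\<close>

lemma (in str0d) counit_iso:
  assumes top: "compact_element T \<top>\<^bsub>T\<^esub>"
  shows "counit M \<in> biframe_iso (cong_biframe (first_part M)) M"
proof -
  let ?F = "first_part M" and ?h = "counit M"
  let ?C = "congruence_frame ?F"
  interpret F: frm ?F by (simp add: frm_def frame_first_part)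
  interpret e: complemented_hom ?F T "\<lambda>x\<in>first M. x" by (rule counit_complemented_hom)
  interpret h: frm_hom ?C T ?h
    by (simp add: F.frame_congruence_frame frame_total counit_hom frm_homI)
  have reflects: "\<theta> \<subseteq> \<phi>"
    if "frame_congruence ?F \<theta>" "frame_congruence ?F \<phi>" "?h \<theta> \<sqsubseteq>\<^bsub>T\<^esub> ?h \<phi>" for \<theta> \<phi>
    by (rule e.ext_reflects_order[OF top]) (use that in \<open>simp_all add: counit_eq le_first_part\<close>)
  have "inj_on ?h (carrier ?C)"
  proof (rule inj_onI)
    fix \<theta> \<phi> assume C: "\<theta> \<in> carrier ?C" "\<phi> \<in> carrier ?C" and eq: "?h \<theta> = ?h \<phi>"
    then have cong: "frame_congruence ?F \<theta>" "frame_congruence ?F \<phi>" by simp_all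
    have "?h \<phi> \<sqsubseteq>\<^bsub>T\<^esub> ?h \<phi>" by (rule e.M.le_refl[OF h.hom_closed[OF C(2)]])
    then show "\<theta> = \<phi>"
      using eq by (intro subset_antisym reflects cong) simp_all
  qed
  moreover have "?h ` carrier ?C = carrier T"
  proof (rule subframe_eq_carrier)
    show "subframe T (?h ` carrier ?C)"
      by (rule h.subframe_image[OF h.L.subframe_carrier])
    have nab: "nabla ?F a \<in> carrier ?C" if "a \<in> first M" for a
      using F.frame_congruence_nabla[of a] that by simp
    show "first M \<subseteq> ?h ` carrier ?C"
    proof
      fix a assume "a \<in> first M"
      then show "a \<in> ?h ` carrier ?C"
        using imageI[OF nab, of a ?h] by (simp add: counit_nabla)
    qed
    show "complements \<subseteq> ?h ` carrier ?C"
    proof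
      fix c assume "c \<in> complements"
      then obtain a where a: "a \<in> first M" "complement_in T a c" by blast
      have d: "complement_in ?C (nabla ?F a) (delta ?F a)"
        by (rule F.nabla_delta_complement) (simp add: a)
      have "complement_in T a (?h (delta ?F a))"
        using h.hom_complement[OF nab[OF a(1)] d] by (simp add: counit_nabla a)
      then have "c = ?h (delta ?F a)"
        by (rule e.M.complement_unique[OF a(2) _ first_closed[OF a(1)]])
      then show "c \<in> ?h ` carrier ?C" using d by (simp add: complement_in_def)
    qed
  qed
  ultimately have bij: "bij_betw ?h (carrier ?C) (carrier T)" by (simp add: bij_betw_def)
  note C0 = F.cong_biframe_str0d
  have first: "?h ` first (cong_biframe ?F) \<subseteq> first M"
    by (auto simp: counit_nabla)
  let ?g = "\<lambda>y\<in>carrier T. inv_into (carrier ?C) ?h y"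
  note g = bij_frame_hom_inverse[OF F.frame_congruence_frame frame_total counit_hom bij]
  have "?g ` first M \<subseteq> first (cong_biframe ?F)"
  proof (rule image_subsetI)
    fix a assume a: "a \<in> first M"
    have n: "nabla ?F a \<in> carrier ?C" using F.frame_congruence_nabla[of a] a by simp
    have "?g a = nabla ?F a"
      using fun_cong[OF g(2), of "nabla ?F a"] n a by (simp add: compose_eq counit_nabla)
    then show "?g a \<in> first (cong_biframe ?F)" using a by simp
  qed
  then have "?g \<in> biframe_hom M (cong_biframe ?F)"
    by (intro biframe_homI str0d C0) (simp_all add: g(1))
  moreover have "?h \<in> biframe_hom (cong_biframe ?F) M"
    by (rule biframe_homI[OF C0 str0d _ first]) (simp add: counit_hom)
  ultimately show ?thesis
    unfolding biframe_iso_def using g(2,3) by auto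
qed

lemma (in frm) unit_iso: "unit L \<in> frame_iso L (first_part (cong_biframe L))"
proof -
  let ?F = "first_part (cong_biframe L)"
  interpret C: str0d "cong_biframe L" by unfold_locales (rule cong_biframe_str0d)
  interpret u: frm_hom L CL "unit L" by (rule unit_frm_hom)
  have hom: "unit L \<in> frame_hom L ?F"
    using u.corestrict_hom[OF subframe_nabla] by (simp add: first_part_def unit_image)
  have "inj_on (unit L) (carrier L)"
    using inj_on_nabla inj_on_cong[of "carrier L" "unit L" "nabla L"] by (simp add: unit_def)
  then have bij: "bij_betw (unit L) (carrier L) (carrier ?F)"
    by (simp add: bij_betw_def unit_image)
  from bij_frame_hom_inverse[OF frame_axioms C.frame_first_part hom bij] hom
  show ?thesis unfolding frame_iso_def by blast
qed

section \<open>The equivalence\<close>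

lemma NoethFrmD:
  assumes "L \<in> NoethFrm"
  shows "frame L" "a \<in> carrier L \<Longrightarrow> compact_element L a"
  using assms by (auto simp: NoethFrm_def Frm_def)

lemma CompactStr0DBiFrmD:
  assumes "M \<in> CompactStr0DBiFrm"
  shows "M \<in> Str0DBiFrm" "compact_element (total M) \<top>\<^bsub>total M\<^esub>"
  using assms by (auto simp: CompactStr0DBiFrm_def compact_frame_def)

lemma str0dI: "M \<in> Str0DBiFrm \<Longrightarrow> str0d M"
  by (simp add: str0d_def)

lemma cong_map_biframe_hom:
  assumes L: "frame L" and M: "frame M" and f: "f \<in> frame_hom L M"
  shows "cong_map L M f \<in> biframe_hom (cong_biframe L) (cong_biframe M)"
proof -
  interpret f: frm_hom L M f by (simp add: L M f frm_homI)
  show ?thesis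
    by (rule biframe_homI[OF f.L.cong_biframe_str0d f.M.cong_biframe_str0d])
      (use cong_map_hom[OF assms] cong_map_nabla[OF assms] f.hom_closed in auto)
qed

lemma cong_map_id:
  assumes L: "frame L"
  shows "cong_map L L (\<lambda>x\<in>carrier L. x) = (\<lambda>\<theta>\<in>carrier (congruence_frame L). \<theta>)"
proof -
  interpret frm L by (simp add: frm_def L)
  show ?thesis
    by (rule cong_map_eqI[OF L L frame_hom_id[OF L] frame_hom_id[OF frame_congruence_frame]])
      (simp add: frame_congruence_nabla)
qed

lemma cong_map_compose:
  assumes L: "frame L" and M: "frame M" and N: "frame N"
    and f: "f \<in> frame_hom L M" and g: "g \<in> frame_hom M N"
  shows "cong_map L N (compose (carrier L) g f) =
    compose (carrier (congruence_frame L)) (cong_map M N g) (cong_map L M f)"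
proof -
  interpret f: frm_hom L M f by (simp add: L M f frm_homI)
  interpret N: frm N by (simp add: N frm_def)
  show ?thesis
  proof (rule cong_map_eqI[OF L N frame_hom_compose[OF L M N f g]])
    show "compose (carrier (congruence_frame L)) (cong_map M N g) (cong_map L M f)
      \<in> frame_hom (congruence_frame L) (congruence_frame N)"
      by (rule frame_hom_compose[OF f.L.frame_congruence_frame f.M.frame_congruence_frame
            N.frame_congruence_frame cong_map_hom[OF L M f] cong_map_hom[OF M N g]])
    fix a assume "a \<in> carrier L"
    then show "compose (carrier (congruence_frame L)) (cong_map M N g) (cong_map L M f) (nabla L a) =
        nabla N (compose (carrier L) g f a)"
      by (simp add: compose_eq f.L.frame_congruence_nabla cong_map_nabla[OF L M f] cong_map_nabla[OF M N g])
  qed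
qed

lemma unit_natural:
  assumes L: "frame L" and M: "frame M" and f: "f \<in> frame_hom L M"
  shows "compose (carrier L) (first_part_map (cong_biframe L) (cong_map L M f)) (unit L) =
    compose (carrier L) (unit M) f"
proof
  interpret f: frm_hom L M f by (simp add: L M f frm_homI)
  fix a
  show "compose (carrier L) (first_part_map (cong_biframe L) (cong_map L M f)) (unit L) a =
    compose (carrier L) (unit M) f a"
    by (cases "a \<in> carrier L")
      (simp_all add: compose_def first_part_map_def unit_def cong_map_nabla[OF assms])
qed

text \<open>
  Both sides are homomorphisms out of a congruence frame that send \<open>nabla\<close> of \<open>a\<close> to \<open>f a\<close>.
\<close>

lemma counit_natural:
  assumes M: "M \<in> Str0DBiFrm" and N: "N \<in> Str0DBiFrm" and f: "f \<in> biframe_hom M N"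
  shows "compose (carrier (total (cong_biframe (first_part M)))) f (counit M) =
    compose (carrier (total (cong_biframe (first_part M)))) (counit N)
      (cong_map (first_part M) (first_part N) (first_part_map M f))"
proof -
  interpret M: str0d M by (rule str0dI[OF M])
  interpret N: str0d N by (rule str0dI[OF N])
  interpret FM: frm "first_part M" by (simp add: frm_def M.frame_first_part)
  interpret FN: frm "first_part N" by (simp add: frm_def N.frame_first_part)
  interpret C: str0d "cong_biframe (first_part M)" by (rule str0dI[OF FM.cong_biframe_str0d])
  have f': "f \<in> frame_hom (total M) (total N)" "f ` first M \<subseteq> first N"
    using f by (auto simp: biframe_hom_def)
  note F = first_part_map_hom[OF M N f]
  note map = cong_map_hom[OF M.frame_first_part N.frame_first_part F]
  note map_nabla = cong_map_nabla[OF M.frame_first_part N.frame_first_part F]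
  show ?thesis
  proof (rule C.hom_eqI[OF N.frame_total], unfold total_cong_biframe)
    let ?C = "carrier (congruence_frame (first_part M))"
    show "compose ?C f (counit M) \<in> frame_hom (congruence_frame (first_part M)) (total N)"
      by (rule frame_hom_compose[OF FM.frame_congruence_frame M.frame_total N.frame_total
            M.counit_hom f'(1)])
    show "compose ?C (counit N) (cong_map (first_part M) (first_part N) (first_part_map M f))
        \<in> frame_hom (congruence_frame (first_part M)) (total N)"
      by (rule frame_hom_compose[OF FM.frame_congruence_frame FN.frame_congruence_frame N.frame_total
            map N.counit_hom])
    fix \<theta> assume "\<theta> \<in> first (cong_biframe (first_part M))"
    then obtain a where a: "a \<in> first M" and \<theta>: "\<theta> = nabla (first_part M) a" by auto
    have "\<theta> \<in> ?C" using FM.frame_congruence_nabla[of a] a by (simp add: \<theta>)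
    moreover have "f a \<in> first N" using a f'(2) by blast
    moreover have "cong_map (first_part M) (first_part N) (first_part_map M f) \<theta> =
        nabla (first_part N) (f a)"
      using map_nabla[of a] a by (simp add: \<theta>) (simp add: first_part_map_def)
    ultimately show "compose ?C f (counit M) \<theta> =
        compose ?C (counit N) (cong_map (first_part M) (first_part N) (first_part_map M f)) \<theta>"
      using a by (simp add: compose_eq) (simp add: \<theta> M.counit_nabla N.counit_nabla)
  qed
qed

lemma first_part_map_id:
  assumes M: "M \<in> Str0DBiFrm"
  shows "first_part_map M (\<lambda>x\<in>carrier (total M). x) = (\<lambda>x\<in>carrier (first_part M). x)"
proof -
  interpret M: str0d M by (rule str0dI[OF M])
  show ?thesis by (rule ext) (simp add: first_part_map_def restrict_def M.first_closed)
qed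

lemma first_part_map_compose:
  assumes M: "M \<in> Str0DBiFrm" and f: "f \<in> biframe_hom M N"
  shows "first_part_map M (compose (carrier (total M)) g f) =
    compose (carrier (first_part M)) (first_part_map N g) (first_part_map M f)"
proof -
  interpret M: str0d M by (rule str0dI[OF M])
  have "f ` first M \<subseteq> first N" using f by (simp add: biframe_hom_def)
  then have "f x \<in> first N" if "x \<in> first M" for x using that by blast
  then show ?thesis
    by (intro ext) (simp add: first_part_map_def restrict_def compose_def M.first_closed)
qed

theorem mainTheorem12:
  shows
    "((\<forall>L\<in>(Frm :: 'a gorder set). cong_biframe L \<in> Str0DBiFrm) \<and>
      (\<forall>L\<in>(Frm :: 'a gorder set). \<forall>M\<in>(Frm :: 'b gorder set). \<forall>f\<in>frame_hom L M.
         cong_map L M f \<in> biframe_hom (cong_biframe L) (cong_biframe M)) \<and>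
      (\<forall>L\<in>(Frm :: 'a gorder set).
         cong_map L L (\<lambda>x\<in>carrier L. x) = (\<lambda>\<theta>\<in>carrier (total (cong_biframe L)). \<theta>)) \<and>
      (\<forall>L\<in>(Frm :: 'a gorder set). \<forall>M\<in>(Frm :: 'b gorder set). \<forall>N\<in>(Frm :: 'c gorder set).
         \<forall>f\<in>frame_hom L M. \<forall>g\<in>frame_hom M N.
           cong_map L N (compose (carrier L) g f) =
           compose (carrier (total (cong_biframe L))) (cong_map M N g) (cong_map L M f)))
     \<and>
     ((\<forall>M\<in>(Str0DBiFrm :: 'd biframe set). first_part M \<in> Frm) \<and>
      (\<forall>M\<in>(Str0DBiFrm :: 'd biframe set). \<forall>N\<in>(Str0DBiFrm :: 'e biframe set).
         \<forall>f\<in>biframe_hom M N. first_part_map M f \<in> frame_hom (first_part M) (first_part N)) \<and>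
      (\<forall>M\<in>(Str0DBiFrm :: 'd biframe set).
         first_part_map M (\<lambda>x\<in>carrier (total M). x) = (\<lambda>x\<in>carrier (first_part M). x)) \<and>
      (\<forall>M\<in>(Str0DBiFrm :: 'd biframe set). \<forall>N\<in>(Str0DBiFrm :: 'e biframe set).
         \<forall>K\<in>(Str0DBiFrm :: 'f biframe set). \<forall>f\<in>biframe_hom M N. \<forall>g\<in>biframe_hom N K.
           first_part_map M (compose (carrier (total M)) g f) =
           compose (carrier (first_part M)) (first_part_map N g) (first_part_map M f)))
     \<and>
     (\<forall>L\<in>(NoethFrm :: 'a gorder set). cong_biframe L \<in> CompactStr0DBiFrm)
     \<and>
     (\<forall>M\<in>(CompactStr0DBiFrm :: 'd biframe set). first_part M \<in> NoethFrm)
     \<and>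
     ((\<forall>L\<in>(NoethFrm :: 'a gorder set). unit L \<in> frame_iso L (first_part (cong_biframe L))) \<and>
      (\<forall>L\<in>(NoethFrm :: 'a gorder set). \<forall>M\<in>(NoethFrm :: 'b gorder set). \<forall>f\<in>frame_hom L M.
         compose (carrier L) (first_part_map (cong_biframe L) (cong_map L M f)) (unit L) =
         compose (carrier L) (unit M) f))
     \<and>
     ((\<forall>M\<in>(CompactStr0DBiFrm :: 'd biframe set).
         counit M \<in> biframe_iso (cong_biframe (first_part M)) M) \<and>
      (\<forall>M\<in>(CompactStr0DBiFrm :: 'd biframe set). \<forall>N\<in>(CompactStr0DBiFrm :: 'e biframe set).
         \<forall>f\<in>biframe_hom M N.
           compose (carrier (total (cong_biframe (first_part M)))) f (counit M) =
           compose (carrier (total (cong_biframe (first_part M)))) (counit N)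
             (cong_map (first_part M) (first_part N) (first_part_map M f))))"
proof (intro conjI ballI)
  fix L :: "'a gorder" assume "L \<in> Frm"
  then show "cong_biframe L \<in> Str0DBiFrm"
    by (simp add: Frm_def frm.cong_biframe_str0d frm_def)
next
  fix L :: "'a gorder" and M :: "'b gorder" and f
  assume "L \<in> Frm" "M \<in> Frm" "f \<in> frame_hom L M"
  then show "cong_map L M f \<in> biframe_hom (cong_biframe L) (cong_biframe M)"
    by (simp add: Frm_def cong_map_biframe_hom)
next
  fix L :: "'a gorder" assume "L \<in> Frm"
  then show "cong_map L L (\<lambda>x\<in>carrier L. x) = (\<lambda>\<theta>\<in>carrier (total (cong_biframe L)). \<theta>)"
    by (simp only: Frm_def mem_Collect_eq cong_map_id total_cong_biframe)
next
  fix L :: "'a gorder" and M :: "'b gorder" and N :: "'c gorder" and f g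
  assume "L \<in> Frm" "M \<in> Frm" "N \<in> Frm" "f \<in> frame_hom L M" "g \<in> frame_hom M N"
  then show "cong_map L N (compose (carrier L) g f) =
      compose (carrier (total (cong_biframe L))) (cong_map M N g) (cong_map L M f)"
    by (simp only: Frm_def mem_Collect_eq cong_map_compose[of L M N] total_cong_biframe)
next
  fix M :: "'d biframe" assume "M \<in> Str0DBiFrm"
  then show "first_part M \<in> Frm"
    by (simp add: Frm_def str0d.frame_first_part str0dI)
next
  fix M :: "'d biframe" and N :: "'e biframe" and f
  assume "M \<in> Str0DBiFrm" "N \<in> Str0DBiFrm" "f \<in> biframe_hom M N"
  then show "first_part_map M f \<in> frame_hom (first_part M) (first_part N)"
    by (rule first_part_map_hom)
next
  fix M :: "'d biframe" assume "M \<in> Str0DBiFrm"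
  then show "first_part_map M (\<lambda>x\<in>carrier (total M). x) = (\<lambda>x\<in>carrier (first_part M). x)"
    by (rule first_part_map_id)
next
  fix M :: "'d biframe" and N :: "'e biframe" and K :: "'f biframe" and f g
  assume "M \<in> Str0DBiFrm" "f \<in> biframe_hom M N"
  then show "first_part_map M (compose (carrier (total M)) g f) =
      compose (carrier (first_part M)) (first_part_map N g) (first_part_map M f)"
    by (rule first_part_map_compose)
next
  fix L :: "'a gorder" assume L: "L \<in> NoethFrm"
  then have "frm L" by (simp add: NoethFrmD(1) frm_def)
  then show "cong_biframe L \<in> CompactStr0DBiFrm"
    using frm.compact_congruence_frame[of L] NoethFrmD(2)[OF L]
    by (simp add: CompactStr0DBiFrm_def frm.cong_biframe_str0d)
next
  fix M :: "'d biframe" assume "M \<in> CompactStr0DBiFrm"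
  then show "first_part M \<in> NoethFrm"
    by (intro str0d.noetherian_first_part str0dI) (rule CompactStr0DBiFrmD; assumption)+
next
  fix L :: "'a gorder" assume "L \<in> NoethFrm"
  then show "unit L \<in> frame_iso L (first_part (cong_biframe L))"
    by (simp add: NoethFrmD(1) frm.unit_iso frm_def)
next
  fix L :: "'a gorder" and M :: "'b gorder" and f
  assume "L \<in> NoethFrm" "M \<in> NoethFrm" "f \<in> frame_hom L M"
  then show "compose (carrier L) (first_part_map (cong_biframe L) (cong_map L M f)) (unit L) =
      compose (carrier L) (unit M) f"
    by (intro unit_natural NoethFrmD(1))
next
  fix M :: "'d biframe" assume "M \<in> CompactStr0DBiFrm"
  then show "counit M \<in> biframe_iso (cong_biframe (first_part M)) M"
    by (intro str0d.counit_iso str0dI) (rule CompactStr0DBiFrmD; assumption)+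
next
  fix M :: "'d biframe" and N :: "'e biframe" and f
  assume "M \<in> CompactStr0DBiFrm" "N \<in> CompactStr0DBiFrm" "f \<in> biframe_hom M N"
  then show "compose (carrier (total (cong_biframe (first_part M)))) f (counit M) =
      compose (carrier (total (cong_biframe (first_part M)))) (counit N)
        (cong_map (first_part M) (first_part N) (first_part_map M f))"
    by (intro counit_natural CompactStr0DBiFrmD(1))
qed

end
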